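(* Under the unequal-cluster-size setting in the context (null log-linear model true), for any admissible $\phi$, \[ \sqrt{N}\big(\widehat{\boldsymbol{p}}-\boldsymbol{p}(\widehat{\boldsymbol{\theta}}_{\phi})\big)\xrightarrow[N\to\infty]{\mathcal{L}}\mathcal{N}\Big(\boldsymbol{0}_M,\ \tfrac{\vartheta_{n^*}}{\bar n}\big(\boldsymbol{\Sigma}_{\boldsymbol{p}(\boldsymbol{\theta}_0)}-\boldsymbol{\Sigma}_{\boldsymbol{p}(\boldsymbol{\theta}_0)}\boldsymbol{W}(\boldsymbol{W}^T\boldsymbol{\Sigma}_{\boldsymbol{p}(\boldsymbol{\theta}_0)}\boldsymbol{W})^{-1}\boldsymbol{W}^T\boldsymbol{\Sigma}_{\boldsymbol{p}(\boldsymbol{\theta}_0)}\big)\Big), \] where $\bar n=\sum_{g=1}^G N_g^*n_g$ and $\vartheta_{n^*}=1+\rho^2(n^*-1)$.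
   Context: Let $M\ge 3$ and $1\le M_0<M-1$. Let $\boldsymbol{W}$ be a real $M\times M_0$ matrix of full column rank whose columns, together with $\boldsymbol{1}_M$, are linearly independent; $\boldsymbol{p}(\boldsymbol{\theta})=\exp\{\boldsymbol{W}\boldsymbol{\theta}\}/(\boldsymbol{1}_M^T\exp\{\boldsymbol{W}\boldsymbol{\theta}\})$ for $\boldsymbol{\theta}\in\mathbb{R}^{M_0}$; $\boldsymbol{D}_{\boldsymbol{p}}=\mathrm{diag}(\boldsymbol{p})$, $\boldsymbol{\Sigma}_{\boldsymbol{p}}=\boldsymbol{D}_{\boldsymbol{p}}-\boldsymbol{p}\boldsymbol{p}^T$. Unequal cluster sizes: there are $G$ groups of clusters; group $g$ contains $N_g$ clusters, each of size $n_g\ge2$ (distinct $n_g$); $N=\sum_{g=1}^G N_g$, and $N_g/N\to N_g^*\in(0,1]$ as $N\to\infty$. The cluster frequency vectors $\boldsymbol{Y}^{(g,\ell)}$, $\ell=1,\dots,N_g$, $g=1,\dots,G$, are independent, with nonnegative integer entries summing to $n_g$, identically distributed within each group, $\mathrm{E}[\boldsymbol{Y}^{(g,\ell)}]=n_g\boldsymbol{p}(\boldsymbol{\theta}_0)$, $\mathrm{Var}[\boldsymbol{Y}^{(g,\ell)}]=\vartheta_{n_g}n_g\boldsymbol{\Sigma}_{\boldsymbol{p}(\boldsymbol{\theta}_0)}$, $\vartheta_{n_g}=1+(n_g-1)\rho^2$, $\rho^2\ge0$, $\boldsymbol{\theta}_0$ the unknown true parameter. Let $\boldsymbol{Y}=\sum_g\sum_\ell\boldsymbol{Y}^{(g,\ell)}$,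 $\widehat{\boldsymbol{p}}=\boldsymbol{Y}/\sum_{h}n_hN_h$. Let $w_g^*=N_g^*n_g/\sum_h N_h^*n_h$ and $n^*=\sum_g w_g^*n_g$. Admissible $\phi:(0,\infty)\to\mathbb{R}$: convex, twice continuously differentiable, $\phi(1)=\phi'(1)=0$, $\phi''(1)>0$, conventions $0\phi(0/0)=0$, $0\phi(p/0)=p\lim_{u\to\infty}\phi(u)/u$; $d_\phi(\boldsymbol{p},\boldsymbol{q})=\sum_r q_r\phi(p_r/q_r)$; QM$\phi$E $\widehat{\boldsymbol{\theta}}_\phi=\arg\min_{\boldsymbol{\theta}}d_\phi(\widehat{\boldsymbol{p}},\boldsymbol{p}(\boldsymbol{\theta}))$ (assumed well defined). *)

theory Defs
  imports "HOL-Probability.Probability"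
begin

definition loglin_p :: "real^'k^'m \<Rightarrow> real^'k \<Rightarrow> real^'m" where
  "loglin_p W \<theta> = (\<chi> r. exp ((W *v \<theta>) $ r) / (\<Sum>s\<in>UNIV. exp ((W *v \<theta>) $ s)))"

definition Sigma_mat :: "real^'m \<Rightarrow> real^'m^'m" where
  "Sigma_mat p = (\<chi> i j. (if i = j then p $ i else 0) - p $ i * p $ j)"

definition admissible_phi :: "(real \<Rightarrow> real) \<Rightarrow> bool" where
  "admissible_phi \<phi> \<longleftrightarrow> convex_on {0<..} \<phi> \<and>
     (\<exists>\<phi>1 \<phi>2. (\<forall>u>0. (\<phi> has_real_derivative \<phi>1 u) (at u)) \<and>
               (\<forall>u>0. (\<phi>1 has_real_derivative \<phi>2 u) (at u)) \<and>
               continuous_on {0<..} \<phi>2 \<and>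
               \<phi> 1 = 0 \<and> \<phi>1 1 = 0 \<and> \<phi>2 1 > 0)"

definition phi_ext :: "(real \<Rightarrow> real) \<Rightarrow> real \<Rightarrow> ereal" where
  "phi_ext \<phi> u = (if u > 0 then ereal (\<phi> u) else Lim (at_right 0) (\<lambda>v. ereal (\<phi> v)))"

text \<open>d_phi(p,q) = sum_r q_r phi(p_r/q_r), with the conventions 0 phi(0/0) = 0 and
  0 phi(p/0) = p lim_{u->inf} phi(u)/u.  Values in the extended reals.\<close>
definition d_phi :: "(real \<Rightarrow> real) \<Rightarrow> real^'m \<Rightarrow> real^'m \<Rightarrow> ereal" where
  "d_phi \<phi> p q = (\<Sum>r\<in>UNIV.
      (if q $ r = 0 then
         (if p $ r = 0 then 0 else ereal (p $ r) * Lim at_top (\<lambda>u. ereal (\<phi> u / u)))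
       else ereal (q $ r) * phi_ext \<phi> (p $ r / q $ r)))"

definition conv_in_law :: "(nat \<Rightarrow> ('b::euclidean_space) measure) \<Rightarrow> 'b measure \<Rightarrow> bool" where
  "conv_in_law \<mu>s \<mu> \<longleftrightarrow>
     (\<forall>f :: 'b \<Rightarrow> real. continuous_on UNIV f \<and> bounded (range f) \<longrightarrow>
        (\<lambda>\<nu>. \<integral>x. f x \<partial>(\<mu>s \<nu>)) \<longlonglongrightarrow> (\<integral>x. f x \<partial>\<mu>))"

text \<open>mu is the (possibly degenerate) centred multivariate normal law N(0, S),
  characterised by its characteristic function exp(-t^T S t / 2).\<close>
definition is_centered_mvn :: "real^'m^'m \<Rightarrow> (real^'m) measure \<Rightarrow> bool" where
  "is_centered_mvn S \<mu> \<longleftrightarrow> prob_space \<mu> \<and> sets \<mu> = sets borel \<and>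
     (\<forall>t. (\<integral>x. cis (t \<bullet> x) \<partial>\<mu>) = complex_of_real (exp (- (t \<bullet> (S *v t)) / 2)))"

end

theory Submission
  imports Defs
begin

text \<open>
  Convexity and \<open>\<phi>''(1) > 0\<close> give \<open>d\<^sub>\<phi>(p, q) \<ge> c |p - q|\<^sup>2\<close> globally, so comparing the
  minimum with \<open>d\<^sub>\<phi>(p, p(\<theta>\<^sub>0)) = O(|p - p\<^sub>0|\<^sup>2)\<close> shows that the estimator satisfies
  \<open>|p(\<theta>) - p\<^sub>0| = O(|p - p\<^sub>0|)\<close> without any compactness of the parameter space.
  The stationarity equation then says \<open>W\<^sup>T (p - p(\<theta>)) = o(|p - p\<^sub>0|)\<close>, and together with the
  derivative \<open>\<Sigma> W\<close> of the model this yields the deterministic expansion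
  \<open>p - p(\<theta>) = (1 - \<Sigma> W (W\<^sup>T \<Sigma> W)\<^sup>-\<^sup>1 W\<^sup>T) (p - p\<^sub>0) + o(|p - p\<^sub>0|)\<close>.
  The clusters are bounded, so a third order expansion of the characteristic function gives the
  limit of \<open>\<surd>N (p - p\<^sub>0)\<close>, and the linear map and the remainder are handled at the
  level of characteristic functions. Convergence of characteristic functions implies convergence
  in law because trigonometric polynomials form a separating algebra and the laws are tight.
\<close>

section \<open>Convergence in law from characteristic functions\<close>

text \<open>Every \<open>\<nu>\<close> has its own probability space and
  \<open>thetahat \<nu>\<close> is just some measurable minimiser, so the estimator cannot be
  followed along a sample path or written as a fixed function of the data. All analysis of the
  estimator is therefore deterministic, with one radius around \<open>loglin_p W \<theta>0\<close>
  that serves all vectors of mass 1 within it and all their minimisers. Randomness enters only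
  through the event that \<open>sqrt N\<close> times the deviation stays below \<open>R\<close>,
  whose complement is controlled by Chebyshev's inequality. The remainder has to be small relative
  to the deviation itself, since it is multiplied by \<open>sqrt N\<close> afterwards. The limiting
  covariance is singular, as it annihilates the vector \<open>1\<close>; the limit law thus has no
  density and is built as a linear image of independent standard normals.\<close>

inductive_set trig_poly :: "('b::euclidean_space \<Rightarrow> real) set" where
  wave: "(\<lambda>x. a * cos (t \<bullet> x + b)) \<in> trig_poly"
| add: "f \<in> trig_poly \<Longrightarrow> g \<in> trig_poly \<Longrightarrow> (\<lambda>x. f x + g x) \<in> trig_poly"

lemma trig_poly_const: "(\<lambda>_. c) \<in> trig_poly"
  using trig_poly.wave[of c 0 0] by simp

text \<open>The product-to-sum formula turns a product of waves into a sum of two waves. The phase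
  \<open>b\<close> lets a single pattern cover sines and constants, so the two introduction rules
  already span an algebra.\<close>

lemma trig_poly_mult_wave:
  assumes "f \<in> trig_poly"
  shows "(\<lambda>x. f x * (a * cos (t \<bullet> x + b))) \<in> trig_poly"
  using assms
proof induction
  case (wave a' t' b')
  have "(\<lambda>x. a' * cos (t' \<bullet> x + b') * (a * cos (t \<bullet> x + b))) =
     (\<lambda>x. a' * a / 2 * cos ((t' - t) \<bullet> x + (b' - b)) + a' * a / 2 * cos ((t' + t) \<bullet> x + (b' + b)))"
  proof
    fix x
    have "(t' - t) \<bullet> x + (b' - b) = (t' \<bullet> x + b') - (t \<bullet> x + b)"
      "(t' + t) \<bullet> x + (b' + b) = (t' \<bullet> x + b') + (t \<bullet> x + b)"
      by (simp_all add: inner_diff_left inner_add_left)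
    then have "cos (t' \<bullet> x + b') * cos (t \<bullet> x + b) =
        (cos ((t' - t) \<bullet> x + (b' - b)) + cos ((t' + t) \<bullet> x + (b' + b))) / 2"
      by (simp only: cos_times_cos)
    then show "a' * cos (t' \<bullet> x + b') * (a * cos (t \<bullet> x + b)) =
      a' * a / 2 * cos ((t' - t) \<bullet> x + (b' - b)) + a' * a / 2 * cos ((t' + t) \<bullet> x + (b' + b))"
      by (simp add: field_simps)
  qed
  then show ?case
    by (simp only:) (intro trig_poly.intros)
next
  case (add f g)
  then show ?case
    using trig_poly.add by (fastforce simp: distrib_right)
qed

lemma trig_poly_mult:
  assumes "g \<in> trig_poly" "f \<in> trig_poly"
  shows "(\<lambda>x. f x * g x) \<in> trig_poly"
  using assms
proof induction
  case (wave a t b)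
  then show ?case by (rule trig_poly_mult_wave)
next
  case (add g h)
  then show ?case
    using trig_poly.add by (fastforce simp: distrib_left)
qed

lemma trig_poly_continuous: "f \<in> trig_poly \<Longrightarrow> continuous_on S f"
  by (induction rule: trig_poly.induct) (auto intro!: continuous_intros)

lemma trig_poly_bounded: "f \<in> trig_poly \<Longrightarrow> \<exists>C. \<forall>x. \<bar>f x\<bar> \<le> C"
proof (induction rule: trig_poly.induct)
  case (wave a t b)
  have "\<bar>a * cos (t \<bullet> x + b)\<bar> \<le> \<bar>a\<bar> * 1" for x
    unfolding abs_mult by (intro mult_left_mono) auto
  then show ?case by blast
next
  case (add f g)
  then obtain C D where "\<forall>x. \<bar>f x\<bar> \<le> C" "\<forall>x. \<bar>g x\<bar> \<le> D" by blast
  then have "\<bar>f x + g x\<bar> \<le> C + D" for x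
    by (meson abs_triangle_ineq add_mono order_trans)
  then show ?case by blast
qed

lemma trig_poly_compose:
  fixes q :: "real \<Rightarrow> real"
  assumes "real_polynomial_function q" "g \<in> trig_poly"
  shows "(\<lambda>x. q (g x)) \<in> trig_poly"
  using assms(1)
proof induction
  case (linear f)
  then obtain c where "f = (\<lambda>x. x * c)"
    using real_bounded_linear by blast
  then show ?case
    using trig_poly_mult[OF trig_poly_const assms(2)] by simp
qed (auto intro: trig_poly_const trig_poly.add trig_poly_mult)

lemma trig_poly_separates:
  fixes x y :: "'b::euclidean_space"
  assumes "x \<noteq> y"
  shows "\<exists>f\<in>trig_poly. f x \<noteq> f y"
proof -
  \<comment> \<open>The scaling makes \<open>t \<bullet> (x - y)\<close> equal to \<open>pi\<close>;
    with phase \<open>- (t \<bullet> x)\<close> the wave is then 1 at \<open>x\<close> and -1 at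
    \<open>y\<close>.\<close>
  define t where "t = (pi / ((x - y) \<bullet> (x - y))) *\<^sub>R (x - y)"
  have "t \<bullet> (x - y) = pi"
    using assms by (simp add: t_def)
  then have "t \<bullet> y + (- (t \<bullet> x)) = - pi"
    by (simp add: inner_diff_right)
  then have "1 * cos (t \<bullet> y + (- (t \<bullet> x))) = -1"
    by simp
  moreover have "1 * cos (t \<bullet> x + (- (t \<bullet> x))) = 1"
    by simp
  ultimately show ?thesis
    using trig_poly.wave[of 1 t "- (t \<bullet> x)"] by (intro bexI) auto
qed

lemma integrable_continuous_bounded:
  fixes f :: "'a::topological_space \<Rightarrow> 'c::{second_countable_topology,banach}"
  assumes "prob_space M" "sets M = sets borel" "continuous_on UNIV f" "\<And>x. norm (f x) \<le> C"
  shows "integrable M f"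
proof -
  interpret prob_space M by fact
  show ?thesis
  proof (rule integrable_const_bound)
    show "f \<in> borel_measurable M"
      unfolding measurable_cong_sets[OF assms(2) refl] by (rule borel_measurable_continuous_onI) fact
    show "AE x in M. norm (f x) \<le> C"
      using assms(4) by simp
  qed
qed

text \<open>A wave with phase is the real part of \<open>cis b\<close> times a character, so its
  integral depends continuously on the characteristic function at \<open>t\<close>; sums follow by
  linearity.\<close>

lemma trig_poly_integral_tendsto:
  fixes \<mu>s :: "nat \<Rightarrow> ('b::euclidean_space) measure"
  assumes ps: "\<And>n. prob_space (\<mu>s n)" "\<And>n. sets (\<mu>s n) = sets borel"
    and p: "prob_space \<mu>" "sets \<mu> = sets borel"
    and char_lim: "\<And>t. (\<lambda>n. \<integral>x. cis (t \<bullet> x) \<partial>\<mu>s n) \<longlonglongrightarrow> (\<integral>x. cis (t \<bullet> x) \<partial>\<mu>)"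
    and f: "f \<in> trig_poly"
  shows "(\<lambda>n. \<integral>x. f x \<partial>\<mu>s n) \<longlonglongrightarrow> (\<integral>x. f x \<partial>\<mu>)"
  using f
proof induction
  case (wave a t b)
  have *: "(\<integral>x. a * cos (t \<bullet> x + b) \<partial>\<kappa>) = a * Re (cis b * (\<integral>x. cis (t \<bullet> x) \<partial>\<kappa>))"
    if k: "prob_space \<kappa>" "sets \<kappa> = sets borel" for \<kappa> :: "'b measure"
  proof -
    have i: "integrable \<kappa> (\<lambda>x. cis (t \<bullet> x))"
      by (rule integrable_continuous_bounded[OF k, of _ 1])
        (auto intro!: continuous_intros simp: cis_conv_exp)
    have "(\<integral>x. a * cos (t \<bullet> x + b) \<partial>\<kappa>) = (\<integral>x. a * Re (cis b * cis (t \<bullet> x)) \<partial>\<kappa>)"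
      by (simp add: cis_mult add.commute)
    also have "\<dots> = a * Re (cis b * (\<integral>x. cis (t \<bullet> x) \<partial>\<kappa>))"
      using i integral_Re[of \<kappa> "\<lambda>x. cis b * cis (t \<bullet> x)"] by (simp del: times_complex.sel)
    finally show ?thesis .
  qed
  show ?case
    unfolding *[OF ps] *[OF p] by (intro tendsto_intros char_lim)
next
  case (add f g)
  have i: "integrable \<kappa> h" if k: "prob_space \<kappa>" "sets \<kappa> = sets borel" and h: "h \<in> trig_poly"
    for \<kappa> :: "'b measure" and h
    using trig_poly_bounded[OF h] integrable_continuous_bounded[OF k trig_poly_continuous[OF h]]
    by auto
  show ?case
    using tendsto_add[OF add.IH]
    by (simp add: Bochner_Integration.integral_add i[OF ps add.hyps(1)] i[OF ps add.hyps(2)]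
        i[OF p add.hyps(1)] i[OF p add.hyps(2)])
qed

text \<open>Stone--Weierstrass approximates f by a trigonometric polynomial only on a compact ball, and gives
  no control outside; composing with a polynomial that is close to the clipping function on the
  range of the approximant restores a global bound and stays inside the algebra.\<close>

lemma trig_poly_approx:
  fixes f :: "'b::euclidean_space \<Rightarrow> real"
  assumes "continuous_on UNIV f" and B: "\<And>x. \<bar>f x\<bar> \<le> B" and e: "0 < e"
  obtains h where "h \<in> trig_poly" "\<And>x. norm x \<le> R \<Longrightarrow> \<bar>f x - h x\<bar> \<le> e" "\<And>x. \<bar>h x\<bar> \<le> B + e"
proof -
  interpret function_ring_on "trig_poly :: ('b \<Rightarrow> real) set" "cball 0 R"
    by unfold_locales
      (auto intro: trig_poly_const trig_poly.add trig_poly_mult trig_poly_separates trig_poly_continuous)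
  obtain g where g: "g \<in> trig_poly" "\<forall>x\<in>cball 0 R. \<bar>f x - g x\<bar> < e / 2"
    using Stone_Weierstrass_basic[of f "e / 2"] continuous_on_subset[OF assms(1)] e by auto
  obtain C where C: "\<And>x. \<bar>g x\<bar> \<le> C"
    using trig_poly_bounded[OF g(1)] by blast
  define clip where "clip = (\<lambda>y. max (-B) (min B y))"
  have "0 \<le> B"
    using B[of 0] by linarith
  have "continuous_on {-C..C} clip"
    unfolding clip_def by (intro continuous_intros)
  then obtain q where q: "real_polynomial_function q" "\<And>y. y \<in> {-C..C} \<Longrightarrow> \<bar>clip y - q y\<bar> < e / 2"
    using Stone_Weierstrass_real_polynomial_function[of "{-C..C}" clip "e / 2"] e
    by (metis compact_Icc half_gt_zero)
  have q': "\<bar>clip (g x) - q (g x)\<bar> < e / 2" for x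
    using C[of x] by (intro q(2)) (simp add: abs_le_iff minus_le_iff)
  show thesis
  proof (rule that)
    show "(\<lambda>x. q (g x)) \<in> trig_poly"
      using trig_poly_compose q g by blast
    show "\<bar>f x - q (g x)\<bar> \<le> e" if "norm x \<le> R" for x
    proof -
      \<comment> \<open>Clipping projects onto the interval from \<open>-B\<close> to
        \<open>B\<close>, which contains the values of \<open>f\<close>, so it cannot move
        \<open>g x\<close> away from \<open>f x\<close>.\<close>
      have "\<bar>f x - clip (g x)\<bar> \<le> \<bar>f x - g x\<bar>"
        using B[of x] by (auto simp: clip_def)
      moreover have "\<bar>f x - g x\<bar> < e / 2"
        using g(2) that by simp
      ultimately show ?thesis
        using q'[of x] by linarith
    qed
    show "\<bar>q (g x)\<bar> \<le> B + e" for x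
    proof -
      have "\<bar>clip (g x)\<bar> \<le> B"
        using \<open>0 \<le> B\<close> by (auto simp: clip_def)
      then show ?thesis
        using q'[of x] e by linarith
    qed
  qed
qed

text \<open>Continuity from above: the tail events decrease to the empty set. This supplies the
  tightness of the limit law in the convergence theorem below.\<close>

lemma (in prob_space) tail_bound_exists:
  fixes X :: "'a \<Rightarrow> 'b::real_normed_vector"
  assumes [measurable]: "(\<lambda>x. norm (X x)) \<in> borel_measurable M" and "0 < e"
  shows "\<exists>R. measure M {x \<in> space M. R < norm (X x)} \<le> e"
proof -
  have "(\<lambda>i. measure M {x \<in> space M. real i < norm (X x)}) \<longlonglongrightarrow> measure M (\<Inter>i. {x \<in> space M. real i < norm (X x)})"
    by (rule finite_Lim_measure_decseq) (auto simp: decseq_def)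
  moreover have "x \<notin> (\<Inter>i. {x \<in> space M. real i < norm (X x)})" for x
    using real_arch_simple[of "norm (X x)"] by (auto simp: not_less)
  then have "(\<Inter>i. {x \<in> space M. real i < norm (X x)}) = {}"
    by blast
  ultimately have "(\<lambda>i. measure M {x \<in> space M. real i < norm (X x)}) \<longlonglongrightarrow> 0"
    by simp
  then have "\<forall>\<^sub>F i in sequentially. measure M {x \<in> space M. real i < norm (X x)} < e"
    using assms(2) by (rule order_tendstoD)
  then show ?thesis
    by (auto dest!: eventually_happens intro: less_imp_le)
qed

lemma integral_diff_le_tail:
  fixes f h :: "'a::real_normed_vector \<Rightarrow> real"
  assumes "prob_space M" and S: "sets M = sets borel" and f: "integrable M f" and h: "integrable M h"
    and close: "\<And>x. norm x \<le> R \<Longrightarrow> \<bar>f x - h x\<bar> \<le> e"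
    and far: "\<And>x. \<bar>f x - h x\<bar> \<le> D" and "0 \<le> e" "0 \<le> D"
    and tail: "measure M {x. R < norm x} \<le> \<delta>"
  shows "\<bar>(\<integral>x. f x \<partial>M) - (\<integral>x. h x \<partial>M)\<bar> \<le> e + D * \<delta>"
proof -
  interpret prob_space M by fact
  have m: "{x. R < norm x} \<in> sets M"
    unfolding S by (intro borel_open open_Collect_less continuous_intros)
  have i: "integrable M (\<lambda>x. e + D * indicator {x. R < norm x} x)"
    using m by (simp add: emeasure_eq_measure)
  have "\<bar>(\<integral>x. f x \<partial>M) - (\<integral>x. h x \<partial>M)\<bar> = \<bar>\<integral>x. f x - h x \<partial>M\<bar>"
    using f h by simp
  also have "\<dots> \<le> (\<integral>x. \<bar>f x - h x\<bar> \<partial>M)"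
    by (rule integral_abs_bound)
  also have "\<dots> \<le> (\<integral>x. e + D * indicator {x. R < norm x} x \<partial>M)"
    using f h i close far \<open>0 \<le> e\<close> 
    by (intro integral_mono) (auto split: split_indicator intro: add_increasing)
  also have "\<dots> = e + D * measure M {x. R < norm x}"
    using m prob_space sets_eq_imp_space_eq[OF S] by (simp add: emeasure_eq_measure)
  also have "\<dots> \<le> e + D * \<delta>"
    using tail \<open>0 \<le> D\<close> by (simp add: mult_left_mono)
  finally show ?thesis .
qed

text \<open>The test function \<open>f\<close> is exchanged for a trigonometric polynomial
  \<open>h\<close>. The exchanges under \<open>\<mu>s n\<close> and under \<open>\<mu>\<close> and
  the convergence of the integral of \<open>h\<close> share the error equally. Tightness enters
  because \<open>h\<close> approximates \<open>f\<close> only on a ball.\<close>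

theorem conv_in_law_charfun:
  fixes \<mu>s :: "nat \<Rightarrow> ('b::euclidean_space) measure"
  assumes ps: "\<And>n. prob_space (\<mu>s n)" "\<And>n. sets (\<mu>s n) = sets borel"
    and p: "prob_space \<mu>" "sets \<mu> = sets borel"
    and char_lim: "\<And>t. (\<lambda>n. \<integral>x. cis (t \<bullet> x) \<partial>\<mu>s n) \<longlonglongrightarrow> (\<integral>x. cis (t \<bullet> x) \<partial>\<mu>)"
    and tight: "\<And>e. 0 < e \<Longrightarrow> \<exists>R. \<forall>\<^sub>F n in sequentially. measure (\<mu>s n) {x. R < norm x} \<le> e"
  shows "conv_in_law \<mu>s \<mu>"
  unfolding conv_in_law_def
proof (intro allI impI, elim conjE)
  fix f :: "'b \<Rightarrow> real"
  assume cf: "continuous_on UNIV f" and "bounded (range f)"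
  then obtain B where B: "\<And>x. \<bar>f x\<bar> \<le> B"
    by (auto simp: bounded_iff)
  have B0: "0 \<le> B"
    using B[of 0] by linarith
  show "(\<lambda>n. \<integral>x. f x \<partial>\<mu>s n) \<longlonglongrightarrow> (\<integral>x. f x \<partial>\<mu>)"
  proof (rule LIMSEQ_I)
    fix r :: real
    assume r: "0 < r"
    \<comment> \<open>Each exchange costs at most \<open>e + D * \<delta>\<close>, and both terms
      are at most \<open>r / 6\<close>. As \<open>e \<le> 1\<close>, the number
      \<open>D = 2 * B + 1\<close> bounds \<open>f - h\<close> everywhere.\<close>
    define e where "e = min 1 (r / 6)"
    have e: "0 < e" "e \<le> 1" "e \<le> r / 6"
      using r by (auto simp: e_def)
    define D where "D = 2 * B + 1"
    have D: "0 < D"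
      using B0 by (simp add: D_def)
    define \<delta> where "\<delta> = r / (6 * D)"
    have \<delta>: "0 < \<delta>" "D * \<delta> = r / 6"
      using r D by (auto simp: \<delta>_def)
    obtain R1 where R1: "\<forall>\<^sub>F n in sequentially. measure (\<mu>s n) {x. R1 < norm x} \<le> \<delta>"
      using tight \<delta> by blast
    have "space \<mu> = UNIV"
      using sets_eq_imp_space_eq[OF p(2)] by simp
    then obtain R2 where R2: "measure \<mu> {x. R2 < norm x} \<le> \<delta>"
      using prob_space.tail_bound_exists[OF p(1), of "\<lambda>x. x" \<delta>] \<delta>
      by (auto simp: measurable_cong_sets[OF p(2) refl])
    define R where "R = max R1 R2"
    have mono: "measure \<kappa> {x. R < norm x} \<le> \<delta>"
      if "prob_space \<kappa>" "sets \<kappa> = sets borel" "measure \<kappa> {x. R' < norm x} \<le> \<delta>" "R' \<le> R"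
      for \<kappa> :: "'b measure" and R'
    proof -
      have "measure \<kappa> {x. R < norm x} \<le> measure \<kappa> {x. R' < norm x}"
      proof (rule finite_measure.finite_measure_mono)
        show "finite_measure \<kappa>"
          using that(1) by (simp add: prob_space.finite_measure)
        show "{x. R' < norm x} \<in> sets \<kappa>"
          unfolding that(2) by (intro borel_open open_Collect_less continuous_intros)
      qed (use that in auto)
      then show ?thesis using that by linarith
    qed
    obtain h where h: "h \<in> trig_poly" "\<And>x. norm x \<le> R \<Longrightarrow> \<bar>f x - h x\<bar> \<le> e" "\<And>x. \<bar>h x\<bar> \<le> B + e"
      using trig_poly_approx[OF cf B e(1)] by blast
    have far: "\<bar>f x - h x\<bar> \<le> D" for x
      using B[of x] h(3)[of x] e by (simp add: D_def)
    have close: "\<bar>(\<integral>x. f x \<partial>\<kappa>) - (\<integral>x. h x \<partial>\<kappa>)\<bar> \<le> r / 3"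
      if k: "prob_space \<kappa>" "sets \<kappa> = sets borel" "measure \<kappa> {x. R' < norm x} \<le> \<delta>" "R' \<le> R"
      for \<kappa> :: "'b measure" and R'
    proof -
      have "integrable \<kappa> f"
        by (rule integrable_continuous_bounded[OF k(1,2) cf, of B]) (simp add: B)
      moreover have "integrable \<kappa> h"
        by (rule integrable_continuous_bounded[OF k(1,2) trig_poly_continuous[OF h(1)], of "B + e"]) (simp add: h(3))
      ultimately have "\<bar>(\<integral>x. f x \<partial>\<kappa>) - (\<integral>x. h x \<partial>\<kappa>)\<bar> \<le> e + D * \<delta>"
        using e D by (intro integral_diff_le_tail[OF k(1,2) _ _ h(2) far _ _ mono[OF k]]) simp_all
      then show ?thesis
        using e \<delta> by linarith
    qed
    have "\<forall>\<^sub>F n in sequentially. \<bar>(\<integral>x. h x \<partial>\<mu>s n) - (\<integral>x. h x \<partial>\<mu>)\<bar> < r / 3"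
      using tendstoD[OF trig_poly_integral_tendsto[OF ps p char_lim h(1)], of "r / 3"] r
      by (simp add: dist_real_def)
    with R1 have "\<forall>\<^sub>F n in sequentially. norm ((\<integral>x. f x \<partial>\<mu>s n) - (\<integral>x. f x \<partial>\<mu>)) < r"
    proof eventually_elim
      case (elim n)
      have "\<bar>(\<integral>x. f x \<partial>\<mu>s n) - (\<integral>x. h x \<partial>\<mu>s n)\<bar> \<le> r / 3"
        using close[OF ps elim(1)] by (simp add: R_def)
      moreover have "\<bar>(\<integral>x. f x \<partial>\<mu>) - (\<integral>x. h x \<partial>\<mu>)\<bar> \<le> r / 3"
        using close[OF p R2] by (simp add: R_def)
      ultimately show ?case
        using elim(2) unfolding real_norm_def by linarith
    qed
    then show "\<exists>no. \<forall>n\<ge>no. norm ((\<integral>x. f x \<partial>\<mu>s n) - (\<integral>x. f x \<partial>\<mu>)) < r"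
      by (simp add: eventually_sequentially)
  qed
qed

section \<open>Sums of independent bounded variables\<close>

lemma cis_sum: "cis (\<Sum>i\<in>I. f i) = (\<Prod>i\<in>I. cis (f i))"
  by (induction I rule: infinite_finite_induct) (auto simp: cis_mult[symmetric])

text \<open>The upper half inverts \<open>exp x \<ge> 1 + x + x\<^sup>2 / 2\<close> and uses that
  the product of \<open>1 - x + x\<^sup>2 / 2\<close> and \<open>1 + x + x\<^sup>2 / 2\<close> is
  \<open>1 + x ^ 4 / 4\<close>; the lower half is the tangent inequality.\<close>

lemma abs_exp_minus_le:
  fixes x :: real
  assumes "0 \<le> x"
  shows "\<bar>exp (- x) - (1 - x)\<bar> \<le> x\<^sup>2 / 2"
proof -
  have pos: "0 < 1 + x + x\<^sup>2 / 2"
    using assms by (simp add: add_pos_nonneg)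
  have "exp (- x) = inverse (exp x)"
    by (rule exp_minus)
  also have "\<dots> \<le> inverse (1 + x + x\<^sup>2 / 2)"
    using exp_lower_Taylor_quadratic[OF assms] pos by (rule le_imp_inverse_le)
  also have "\<dots> \<le> 1 - x + x\<^sup>2 / 2"
  proof -
    have "1 \<le> 1 + x ^ 4 / 4"
      by simp
    also have "\<dots> = (1 - x + x\<^sup>2 / 2) * (1 + x + x\<^sup>2 / 2)"
      by (simp add: field_simps power2_eq_square power4_eq_xxxx)
    finally show ?thesis
      using pos by (simp add: inverse_eq_divide divide_le_eq)
  qed
  finally show ?thesis
    using exp_ge_add_one_self[of "-x"] by (simp add: abs_le_iff)
qed

lemma cis_quadratic_approx: "cmod (cis x - (1 + \<i> * x - x\<^sup>2 / 2)) \<le> \<bar>x\<bar> ^ 3 / 6"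
  using iexp_approx1[of x 2]
  by (simp add: cis_conv_exp numeral_2_eq_2 numeral_3_eq_3 fact_numeral power2_eq_square
      algebra_simps flip: of_real_mult)

text \<open>Both sides are compared with \<open>1 - v / 2\<close>: the Taylor remainder of
  \<open>cis\<close> gives \<open>b ^ 3 / 6\<close>, and \<open>v \<le> b\<^sup>2\<close> turns the
  error of the exponential into \<open>b ^ 4 / 8\<close>. The powers of \<open>b\<close> stay
  explicit because \<open>b\<close> will shrink like the inverse square root of the number of
  summands.\<close>

lemma (in prob_space) char_bounded_approx:
  fixes X :: "'a \<Rightarrow> real"
  assumes [measurable]: "X \<in> borel_measurable M"
    and b: "\<And>\<omega>. \<omega> \<in> space M \<Longrightarrow> \<bar>X \<omega>\<bar> \<le> b"
    and mean: "expectation X = 0" and var: "expectation (\<lambda>\<omega>. (X \<omega>)\<^sup>2) = v"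
  shows "cmod (expectation (\<lambda>\<omega>. cis (X \<omega>)) - complex_of_real (exp (- v / 2))) \<le> b ^ 3 / 6 + b ^ 4 / 8"
proof -
  have [measurable]: "(\<lambda>\<omega>. cis (X \<omega>)) \<in> borel_measurable M"
    unfolding cis_conv_exp by measurable
  have i1: "integrable M X"
    by (rule integrable_const_bound[of _ b]) (use b in auto)
  have b2: "(X \<omega>)\<^sup>2 \<le> b\<^sup>2" and b3: "\<bar>X \<omega>\<bar> ^ 3 \<le> b ^ 3" if "\<omega> \<in> space M" for \<omega>
    using power_mono[OF b[OF that], of 2] power_mono[OF b[OF that], of 3] by auto
  have i2: "integrable M (\<lambda>\<omega>. (X \<omega>)\<^sup>2)"
    by (rule integrable_const_bound[of _ "b\<^sup>2"]) (use b2 in auto)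
  have ic: "integrable M (\<lambda>\<omega>. cis (X \<omega>))"
    by (rule integrable_const_bound[of _ 1]) auto
  have iq: "integrable M (\<lambda>\<omega>. 1 + \<i> * X \<omega> - (X \<omega>)\<^sup>2 / 2)"
    using i1 i2 by (intro Bochner_Integration.integrable_add Bochner_Integration.integrable_diff
        integrable_mult_right integrable_divide integrable_of_real) (auto simp flip: of_real_power)
  have v: "0 \<le> v" "v \<le> b\<^sup>2"
  proof -
    show "0 \<le> v"
      unfolding var[symmetric] by simp
    show "v \<le> b\<^sup>2"
      unfolding var[symmetric] using i2 b2 by (intro integral_le_const) auto
  qed
  have "expectation (\<lambda>\<omega>. 1 + \<i> * X \<omega> - (X \<omega>)\<^sup>2 / 2) =
      expectation (\<lambda>\<omega>. complex_of_real (1 - (X \<omega>)\<^sup>2 / 2)) + \<i> * expectation (\<lambda>\<omega>. complex_of_real (X \<omega>))"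
  proof -
    have "integrable M (\<lambda>\<omega>. complex_of_real (1 - (X \<omega>)\<^sup>2 / 2))" "integrable M (\<lambda>\<omega>. \<i> * complex_of_real (X \<omega>))"
      using i1 i2 by (intro integrable_of_real integrable_mult_right; simp)+
    then have "expectation (\<lambda>\<omega>. complex_of_real (1 - (X \<omega>)\<^sup>2 / 2) + \<i> * complex_of_real (X \<omega>)) =
        expectation (\<lambda>\<omega>. complex_of_real (1 - (X \<omega>)\<^sup>2 / 2)) + expectation (\<lambda>\<omega>. \<i> * complex_of_real (X \<omega>))"
      by (rule Bochner_Integration.integral_add)
    then show ?thesis
      by (simp add: algebra_simps)
  qed
  also have "\<dots> = complex_of_real (1 - v / 2)"
    using i2 by (simp add: mean var prob_space del: of_real_diff of_real_divide of_real_power)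
  finally have q: "expectation (\<lambda>\<omega>. 1 + \<i> * X \<omega> - (X \<omega>)\<^sup>2 / 2) = complex_of_real (1 - v / 2)" .
  have "cmod (expectation (\<lambda>\<omega>. cis (X \<omega>)) - complex_of_real (1 - v / 2)) =
      cmod (expectation (\<lambda>\<omega>. cis (X \<omega>) - (1 + \<i> * X \<omega> - (X \<omega>)\<^sup>2 / 2)))"
    unfolding q[symmetric] by (rule arg_cong[of _ _ cmod], rule Bochner_Integration.integral_diff[OF ic iq, symmetric])
  also have "\<dots> \<le> expectation (\<lambda>\<omega>. cmod (cis (X \<omega>) - (1 + \<i> * X \<omega> - (X \<omega>)\<^sup>2 / 2)))"
    by (rule integral_norm_bound)
  also have "\<dots> \<le> b ^ 3 / 6"
  proof (rule integral_le_const)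
    show "integrable M (\<lambda>\<omega>. cmod (cis (X \<omega>) - (1 + \<i> * X \<omega> - (X \<omega>)\<^sup>2 / 2)))"
      by (rule integrable_norm, rule Bochner_Integration.integrable_diff[OF ic iq])
    show "AE \<omega> in M. cmod (cis (X \<omega>) - (1 + \<i> * X \<omega> - (X \<omega>)\<^sup>2 / 2)) \<le> b ^ 3 / 6"
    proof (rule AE_I2)
      fix \<omega> assume "\<omega> \<in> space M"
      then show "cmod (cis (X \<omega>) - (1 + \<i> * X \<omega> - (X \<omega>)\<^sup>2 / 2)) \<le> b ^ 3 / 6"
        using cis_quadratic_approx[of "X \<omega>"] b3[of \<omega>] by linarith
    qed
  qed
  finally have 1: "cmod (expectation (\<lambda>\<omega>. cis (X \<omega>)) - complex_of_real (1 - v / 2)) \<le> b ^ 3 / 6" .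
  have "\<bar>exp (- (v / 2)) - (1 - v / 2)\<bar> \<le> (v / 2)\<^sup>2 / 2"
    using v by (intro abs_exp_minus_le) simp
  also have "\<dots> \<le> b ^ 4 / 8"
    using power_mono[OF v(2,1), of 2] by (simp add: power_divide flip: power_mult)
  finally have 2: "cmod (complex_of_real (1 - v / 2) - complex_of_real (exp (- v / 2))) \<le> b ^ 4 / 8"
    unfolding of_real_diff[symmetric] norm_of_real by (simp add: abs_minus_commute)
  show ?thesis
    using norm_triangle_ineq[of "expectation (\<lambda>\<omega>. cis (X \<omega>)) - complex_of_real (1 - v / 2)"
        "complex_of_real (1 - v / 2) - complex_of_real (exp (- v / 2))"] 1 2
    by simp
qed

text \<open>A product of factors in the closed unit disc changes by at most the sum of the changes
  of its factors. With \<open>b\<close> of order \<open>card I\<close> to the power -1/2 the bound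
  tends to 0, so this serves as a central limit theorem for bounded triangular arrays.\<close>

lemma (in prob_space) char_sum_bounded_approx:
  fixes X :: "'i \<Rightarrow> 'a \<Rightarrow> real"
  assumes I: "finite I" and ind: "indep_vars (\<lambda>_. borel) X I"
    and b: "\<And>i \<omega>. i \<in> I \<Longrightarrow> \<omega> \<in> space M \<Longrightarrow> \<bar>X i \<omega>\<bar> \<le> b"
    and mean: "\<And>i. i \<in> I \<Longrightarrow> expectation (X i) = 0"
    and var: "\<And>i. i \<in> I \<Longrightarrow> expectation (\<lambda>\<omega>. (X i \<omega>)\<^sup>2) = v i"
  shows "cmod (expectation (\<lambda>\<omega>. cis (\<Sum>i\<in>I. X i \<omega>)) - complex_of_real (exp (- (\<Sum>i\<in>I. v i) / 2)))
    \<le> card I * (b ^ 3 / 6 + b ^ 4 / 8)"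
proof -
  have rv: "X i \<in> borel_measurable M" if "i \<in> I" for i
    using ind that by (auto simp: indep_vars_def)
  have cm: "cis \<in> borel_measurable borel"
    unfolding cis_conv_exp by measurable
  have ind': "indep_vars (\<lambda>_. borel) (\<lambda>i \<omega>. cis (X i \<omega>)) I"
    using ind cm by (rule indep_vars_compose2)
  have int: "integrable M (\<lambda>\<omega>. cis (X i \<omega>))" if "i \<in> I" for i
    by (rule integrable_const_bound[of _ 1]) (auto intro!: measurable_compose[OF rv[OF that] cm])
  have v0: "0 \<le> v i" if "i \<in> I" for i
    unfolding var[OF that, symmetric] by simp
  have "expectation (\<lambda>\<omega>. cis (\<Sum>i\<in>I. X i \<omega>)) = (\<Prod>i\<in>I. expectation (\<lambda>\<omega>. cis (X i \<omega>)))"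
    unfolding cis_sum by (rule indep_vars_lebesgue_integral[OF I ind' int])
  moreover have "complex_of_real (exp (- (\<Sum>i\<in>I. v i) / 2)) = (\<Prod>i\<in>I. complex_of_real (exp (- v i / 2)))"
  proof -
    have "- (\<Sum>i\<in>I. v i) / 2 = (\<Sum>i\<in>I. - v i / 2)"
      by (simp add: sum_negf flip: sum_divide_distrib)
    then show ?thesis
      by (simp only: exp_sum[OF I] of_real_prod)
  qed
  moreover have "cmod ((\<Prod>i\<in>I. expectation (\<lambda>\<omega>. cis (X i \<omega>))) - (\<Prod>i\<in>I. complex_of_real (exp (- v i / 2))))
      \<le> (\<Sum>i\<in>I. cmod (expectation (\<lambda>\<omega>. cis (X i \<omega>)) - complex_of_real (exp (- v i / 2))))"
  proof (rule norm_prod_diff)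
    fix i assume i: "i \<in> I"
    have "cmod (expectation (\<lambda>\<omega>. cis (X i \<omega>))) \<le> expectation (\<lambda>\<omega>. cmod (cis (X i \<omega>)))"
      by (rule integral_norm_bound)
    then show "cmod (expectation (\<lambda>\<omega>. cis (X i \<omega>))) \<le> 1"
      by (simp add: prob_space)
    show "cmod (complex_of_real (exp (- v i / 2))) \<le> 1"
      using v0[OF i] by simp
  qed
  moreover have "\<dots> \<le> (\<Sum>i\<in>I. b ^ 3 / 6 + b ^ 4 / 8)"
    using char_bounded_approx[OF rv b mean var] by (intro sum_mono) blast
  ultimately show ?thesis
    by simp
qed

section \<open>Gaussian laws with a possibly singular covariance\<close>

lemma gaussian_measure_exists:
  fixes f :: "real^'m \<Rightarrow> real^'n"
  assumes lin: "linear f"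
  shows "\<exists>\<mu> :: (real^'m) measure. prob_space \<mu> \<and> sets \<mu> = sets borel \<and>
    (\<forall>t. (\<integral>x. cis (t \<bullet> x) \<partial>\<mu>) = complex_of_real (exp (- (norm (f t))\<^sup>2 / 2)))"
proof -
  define N where "N = Pi\<^sub>M (UNIV :: 'n set) (\<lambda>_. std_normal_distribution)"
  \<comment> \<open>\<open>g z\<close> is \<open>adjoint f\<close> applied to the vector with
    coordinates \<open>z i\<close>, so \<open>t \<bullet> g z\<close> is the inner product of
    \<open>f t\<close> with independent standard normals. As \<open>f\<close> may have any rank,
    singular covariances are covered.\<close>
  define g where "g z = (\<Sum>i\<in>UNIV. z i *\<^sub>R adjoint f (axis i 1))" for z :: "'n \<Rightarrow> real"
  have std: "prob_space std_normal_distribution"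
    by (rule prob_space_normal_density) simp
  interpret S: product_prob_space "\<lambda>_::'n. std_normal_distribution" UNIV
    using std by (simp add: product_prob_space_def product_prob_space_axioms_def product_sigma_finite_def
      prob_space_imp_sigma_finite)
  have N: "prob_space N"
    unfolding N_def by (rule prob_space_PiM) (rule std)
  have gm: "g \<in> measurable N borel"
  proof -
    have [measurable]: "(\<lambda>z. z i) \<in> borel_measurable N" for i
      unfolding N_def using measurable_component_singleton[of i UNIV "\<lambda>_. std_normal_distribution"]
      by simp
    show ?thesis
      unfolding g_def by measurable
  qed
  have cm: "(\<lambda>x. cis (t \<bullet> x)) \<in> borel_measurable borel" for t :: "real^'m"
    unfolding cis_conv_exp by measurable
  have char: "(\<integral>x. cis (t \<bullet> x) \<partial>distr N borel g) = complex_of_real (exp (- (norm (f t))\<^sup>2 / 2))" for t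
  proof -
    have "t \<bullet> g z = (\<Sum>i\<in>UNIV. f t $ i * z i)" for z
      by (simp add: g_def inner_sum_right adjoint_works[OF lin] inner_axis mult.commute)
    then have "(\<integral>x. cis (t \<bullet> x) \<partial>distr N borel g) = (\<integral>z. (\<Prod>i\<in>UNIV. iexp (f t $ i * z i)) \<partial>N)"
      by (simp add: integral_distr[OF gm cm] cis_sum) (simp add: cis_conv_exp)
    also have "\<dots> = (\<Prod>i\<in>UNIV. char std_normal_distribution (f t $ i))"
      unfolding N_def char_def
    proof (rule S.product_integral_prod)
      fix i
      show "integrable std_normal_distribution (\<lambda>x. iexp (f t $ i * x))"
        by (rule finite_measure.integrable_const_bound[OF prob_space.finite_measure[OF std], of _ 1]) auto
    qed simp
    also have "\<dots> = complex_of_real (exp (\<Sum>i\<in>UNIV. - (f t $ i)\<^sup>2 / 2))"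
      by (simp add: char_std_normal_distribution exp_sum flip: of_real_prod)
    also have "(\<Sum>i\<in>UNIV. - (f t $ i)\<^sup>2 / 2) = - (norm (f t))\<^sup>2 / 2"
      unfolding power2_norm_eq_inner
      by (simp add: inner_vec_def sum_negf power2_eq_square flip: sum_divide_distrib)
    finally show ?thesis .
  qed
  show ?thesis
    using prob_space.prob_space_distr[OF N gm] char by (intro exI[of _ "distr N borel g"]) simp
qed

section \<open>The log-linear model\<close>

lemma loglin_p_pos: "0 < loglin_p W \<theta> $ r"
  unfolding loglin_p_def by (auto intro!: divide_pos_pos sum_pos)

lemma loglin_p_sum: "(\<Sum>r\<in>UNIV. loglin_p W \<theta> $ r) = 1"
proof -
  have "(\<Sum>s\<in>UNIV. exp ((W *v \<theta>) $ s)) \<noteq> 0"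
    by (metis UNIV_not_empty exp_gt_zero finite less_irrefl sum_pos)
  then show ?thesis
    by (simp add: loglin_p_def flip: sum_divide_distrib)
qed

lemma loglin_p_le_1: "loglin_p W \<theta> $ r \<le> 1"
  unfolding loglin_p_sum[of W \<theta>, symmetric]
  by (rule member_le_sum) (auto intro: less_imp_le loglin_p_pos)

lemma ln_loglin_p:
  "ln (loglin_p W \<theta> $ r) = (W *v \<theta>) $ r - ln (\<Sum>s\<in>UNIV. exp ((W *v \<theta>) $ s))"
proof -
  have "0 < (\<Sum>s\<in>UNIV. exp ((W *v \<theta>) $ s))"
    by (simp add: sum_pos)
  then show ?thesis
    unfolding loglin_p_def by (simp add: ln_div)
qed

lemma Sigma_mat_mult_nth:
  "(Sigma_mat p *v x) $ i = p $ i * (x $ i - (\<Sum>j\<in>UNIV. p $ j * x $ j))"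
proof -
  have "(Sigma_mat p *v x) $ i =
      (\<Sum>j\<in>UNIV. (if i = j then p $ i * x $ i else 0)) - (\<Sum>j\<in>UNIV. p $ i * (p $ j * x $ j))"
    unfolding sum_subtractf[symmetric]
    by (simp add: Sigma_mat_def matrix_vector_mult_def) (rule sum.cong, auto simp: algebra_simps)
  then show ?thesis
    by (simp add: algebra_simps sum_distrib_left)
qed

lemma inner_Sigma_mat:
  "y \<bullet> (Sigma_mat p *v x) =
    (\<Sum>i\<in>UNIV. p $ i * (y $ i * x $ i)) - (\<Sum>i\<in>UNIV. p $ i * y $ i) * (\<Sum>i\<in>UNIV. p $ i * x $ i)"
  unfolding inner_vec_def Sigma_mat_mult_nth
  by (simp add: algebra_simps sum_subtractf sum_distrib_left sum_distrib_right)

lemma inner_Sigma_mat_commute: "y \<bullet> (Sigma_mat p *v x) = (Sigma_mat p *v y) \<bullet> x"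
  unfolding inner_Sigma_mat inner_commute[of "Sigma_mat p *v y"] by (simp add: mult.commute)

text \<open>The form is the variance of the coordinates of \<open>x\<close> under the weights
  \<open>p\<close>. It exposes the kernel of \<open>Sigma_mat p\<close> for positive weights and
  provides an explicit factorisation for the limit law.\<close>

lemma Sigma_mat_quadratic_form:
  assumes "(\<Sum>i\<in>UNIV. p $ i) = 1"
  shows "x \<bullet> (Sigma_mat p *v x) = (\<Sum>i\<in>UNIV. p $ i * (x $ i - (\<Sum>j\<in>UNIV. p $ j * x $ j))\<^sup>2)"
proof -
  define m where "m = (\<Sum>j\<in>UNIV. p $ j * x $ j)"
  have "(\<Sum>i\<in>UNIV. p $ i * (x $ i - m)\<^sup>2) =
      (\<Sum>i\<in>UNIV. p $ i * (x $ i * x $ i)) - 2 * m * (\<Sum>i\<in>UNIV. p $ i * x $ i) + m * m * (\<Sum>i\<in>UNIV. p $ i)"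
    unfolding sum_distrib_left sum_subtractf[symmetric] sum.distrib[symmetric]
    by (rule sum.cong) (auto simp: power2_eq_square algebra_simps)
  also have "\<dots> = x \<bullet> (Sigma_mat p *v x)"
    by (simp add: inner_Sigma_mat assms m_def[symmetric])
  finally show ?thesis
    by (simp add: m_def)
qed

lemma has_derivative_loglin_p:
  "(loglin_p W has_derivative (\<lambda>h. Sigma_mat (loglin_p W \<theta>) *v (W *v h))) (at \<theta>)"
proof -
  have Z: "0 < (\<Sum>s\<in>UNIV. exp ((W *v \<theta>) $ s))"
    by (simp add: sum_pos)
  have lin: "((\<lambda>\<theta>. (W *v \<theta>) $ r) has_derivative (\<lambda>h. (W *v h) $ r)) (at \<theta>)" for r
    by (intro bounded_linear_imp_has_derivative bounded_linear_compose[OF bounded_linear_vec_nth]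
        matrix_vector_mul_bounded_linear)
  have "((\<lambda>\<theta>. loglin_p W \<theta> $ r) has_derivative (\<lambda>h. (Sigma_mat (loglin_p W \<theta>) *v (W *v h)) $ r)) (at \<theta>)"
    for r
  proof -
    let ?Z = "\<Sum>s\<in>UNIV. exp ((W *v \<theta>) $ s)"
    have "((\<lambda>\<theta>. exp ((W *v \<theta>) $ r) / (\<Sum>s\<in>UNIV. exp ((W *v \<theta>) $ s))) has_derivative
       (\<lambda>h. (exp ((W *v \<theta>) $ r) * (W *v h) $ r * ?Z - exp ((W *v \<theta>) $ r) * (\<Sum>s\<in>UNIV. exp ((W *v \<theta>) $ s) * (W *v h) $ s))
         / (?Z * ?Z))) (at \<theta>)"
      using Z by (auto intro!: derivative_eq_intros lin simp: algebra_simps)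
    moreover have "(exp ((W *v \<theta>) $ r) * (W *v h) $ r * ?Z - exp ((W *v \<theta>) $ r) * (\<Sum>s\<in>UNIV. exp ((W *v \<theta>) $ s) * (W *v h) $ s))
         / (?Z * ?Z) = (Sigma_mat (loglin_p W \<theta>) *v (W *v h)) $ r" for h
      using Z unfolding Sigma_mat_mult_nth loglin_p_def
      by (simp add: field_simps flip: sum_divide_distrib)
    ultimately show ?thesis
      by (simp add: loglin_p_def)
  qed
  then show ?thesis
    by (subst has_derivative_componentwise_within) (auto simp: Basis_vec_def inner_axis)
qed

lemma continuous_on_loglin_p: "continuous_on S (loglin_p W)"
  by (intro continuous_at_imp_continuous_on ballI has_derivative_continuous[OF has_derivative_loglin_p])

text \<open>Logarithms make the model affine: \<open>ln\<close> of the model vector is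
  \<open>W *v \<theta>\<close> minus a multiple of \<open>1\<close>. The map \<open>?L\<close> is
  linear and injective, hence bounded below, so log-probabilities control \<open>\<theta>\<close>
  globally and convergence of the probabilities forces convergence of the parameters.\<close>

lemma loglin_p_inverse_tendsto:
  fixes W :: "real^'k^'m"
  assumes ind: "\<forall>c a. W *v c + a *\<^sub>R (1 :: real^'m) = 0 \<longrightarrow> c = 0 \<and> a = 0"
    and lim: "((\<lambda>x. loglin_p W (T x)) \<longlongrightarrow> loglin_p W \<theta>0) F"
  shows "(T \<longlongrightarrow> \<theta>0) F"
proof -
  let ?L = "\<lambda>(c, a). W *v c + a *\<^sub>R (1 :: real^'m)"
  have "linear ?L"
    by (rule linearI) (auto simp: matrix_vector_right_distrib matrix_vector_mult_scaleR algebra_simps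
        scaleR_right_distrib)
  moreover have "inj ?L"
    unfolding linear_injective_0[OF \<open>linear ?L\<close>] using ind by (auto simp: zero_prod_def)
  ultimately obtain B where B: "B > 0" "\<And>z. B * norm z \<le> norm (?L z)"
    using linear_inj_bounded_below_pos by blast
  define lnv where "lnv v = (\<chi> r. ln (v $ r))" for v :: "real^'m"
  have bnd: "norm (\<theta> - \<theta>0) \<le> norm (lnv (loglin_p W \<theta>) - lnv (loglin_p W \<theta>0)) / B" for \<theta>
  proof -
    define a where "a = ln (\<Sum>s\<in>UNIV. exp ((W *v \<theta>0) $ s)) - ln (\<Sum>s\<in>UNIV. exp ((W *v \<theta>) $ s))"
    have "lnv (loglin_p W \<theta>) - lnv (loglin_p W \<theta>0) = ?L (\<theta> - \<theta>0, a)"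
      by (simp add: lnv_def ln_loglin_p vec_eq_iff a_def matrix_vector_mult_diff_distrib)
    moreover have "norm (\<theta> - \<theta>0) \<le> norm (\<theta> - \<theta>0, a)"
      using norm_fst_le[of "\<theta> - \<theta>0" a] by simp
    then have "B * norm (\<theta> - \<theta>0) \<le> B * norm (\<theta> - \<theta>0, a)"
      using B(1) by simp
    then have "B * norm (\<theta> - \<theta>0) \<le> norm (?L (\<theta> - \<theta>0, a))"
      using B(2) by (rule order_trans)
    ultimately show ?thesis
      using B(1) by (simp add: pos_le_divide_eq mult.commute)
  qed
  have "((\<lambda>x. lnv (loglin_p W (T x))) \<longlongrightarrow> lnv (loglin_p W \<theta>0)) F"
    unfolding lnv_def using loglin_p_pos[of W \<theta>0]
    by (intro tendsto_vec_lambda tendsto_ln tendsto_vec_nth lim) (auto simp: less_imp_neq[symmetric])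
  then have "((\<lambda>x. norm (lnv (loglin_p W (T x)) - lnv (loglin_p W \<theta>0)) / B) \<longlongrightarrow> 0) F"
    using B(1) by (intro tendsto_divide_zero tendsto_norm_zero) (simp add: LIM_zero)
  then have "((\<lambda>x. T x - \<theta>0) \<longlongrightarrow> 0) F"
    by (rule Lim_null_comparison[rotated]) (simp add: bnd)
  then show ?thesis
    by (simp add: LIM_zero_cancel)
qed

text \<open>If \<open>c\<close> lies in the kernel, \<open>W *v c\<close> has zero variance under
  the positive weights \<open>loglin_p W \<theta>\<close>, so it is a constant vector, and
  independence from \<open>1\<close> forces \<open>c = 0\<close>.\<close>

lemma Fisher_information_invertible:
  fixes W :: "real^'k^'m"
  assumes ind: "\<forall>c a. W *v c + a *\<^sub>R (1 :: real^'m) = 0 \<longrightarrow> c = 0 \<and> a = 0"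
  shows "invertible (transpose W ** Sigma_mat (loglin_p W \<theta>) ** W)"
proof -
  let ?p = "loglin_p W \<theta>"
  have "c = 0" if "(transpose W ** Sigma_mat ?p ** W) *v c = 0" for c
  proof -
    define x where "x = W *v c"
    define m where "m = (\<Sum>i\<in>UNIV. ?p $ i * x $ i)"
    have "0 = c \<bullet> ((transpose W ** Sigma_mat ?p ** W) *v c)"
      using that by simp
    also have "\<dots> = x \<bullet> (Sigma_mat ?p *v x)"
      by (simp add: x_def flip: matrix_vector_mul_assoc)
        (simp add: dot_lmul_matrix flip: vector_transpose_matrix)
    also have "\<dots> = (\<Sum>i\<in>UNIV. ?p $ i * (x $ i - m)\<^sup>2)"
      unfolding m_def by (rule Sigma_mat_quadratic_form[OF loglin_p_sum])
    finally have "(\<Sum>i\<in>UNIV. ?p $ i * (x $ i - m)\<^sup>2) = 0" by simp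
    then have "\<forall>i. ?p $ i * (x $ i - m)\<^sup>2 = 0"
      by (subst (asm) sum_nonneg_eq_0_iff) (auto intro!: mult_nonneg_nonneg less_imp_le[OF loglin_p_pos])
    then have "x $ i = m" for i
      using loglin_p_pos[of W \<theta> i] by (metis less_irrefl mult_eq_0_iff power2_eq_square right_minus_eq)
    then have "W *v c + (- m) *\<^sub>R 1 = 0"
      by (simp add: vec_eq_iff flip: x_def)
    then show "c = 0"
      using ind by blast
  qed
  then show ?thesis
    by (simp add: invertible_left_inverse matrix_left_invertible_ker)
qed

lemma matrix_inv_inverse:
  fixes A :: "real^'n^'n"
  assumes "invertible A"
  shows "A ** matrix_inv A = mat 1" "matrix_inv A ** A = mat 1"
  using someI_ex[OF assms[unfolded invertible_def]] unfolding matrix_inv_def by auto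

section \<open>Local and global bounds for the divergence\<close>

text \<open>Near 1 the Taylor formula, with \<open>\<phi>2\<close> within \<open>k / 2\<close> of
  its value \<open>k\<close> at 1, gives both bounds. Far from 1 convexity yields only linear
  growth, hence the minimum of a square and an absolute value in the lower bound.\<close>

lemma admissible_phi_bounds:
  assumes "admissible_phi \<phi>"
  obtains c K \<delta> where "0 < c" "0 < K" "0 < \<delta>"
    "\<And>u. 0 < u \<Longrightarrow> c * min ((u - 1)\<^sup>2) \<bar>u - 1\<bar> \<le> \<phi> u"
    "\<And>u. \<bar>u - 1\<bar> < \<delta> \<Longrightarrow> \<phi> u \<le> K * (u - 1)\<^sup>2"
proof -
  obtain \<phi>1 \<phi>2 where conv: "convex_on {0<..} \<phi>"
    and d1: "\<And>u. u > 0 \<Longrightarrow> (\<phi> has_real_derivative \<phi>1 u) (at u)"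
    and d2: "\<And>u. u > 0 \<Longrightarrow> (\<phi>1 has_real_derivative \<phi>2 u) (at u)"
    and cont: "continuous_on {0<..} \<phi>2" and at1: "\<phi> 1 = 0" "\<phi>1 1 = 0" "\<phi>2 1 > 0"
    using assms unfolding admissible_phi_def by blast
  define k where "k = \<phi>2 1"
  have k: "0 < k"
    using at1 by (simp add: k_def)
  have "isCont \<phi>2 1"
    using cont by (simp add: continuous_on_eq_continuous_at)
  then obtain d where d: "0 < d" "\<And>u. \<bar>u - 1\<bar> < d \<Longrightarrow> \<bar>\<phi>2 u - k\<bar> < k / 2"
    unfolding continuous_at_eps_delta dist_real_def k_def[symmetric] using k by (meson half_gt_zero)
  \<comment> \<open>The cap \<open>1 / 2\<close> keeps the Taylor interval inside the positive
    half-line; \<open>d / 2\<close> keeps the intermediate point within the range of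
    \<open>d\<close>.\<close>
  define \<delta> where "\<delta> = min (1 / 2) (d / 2)"
  have \<delta>: "0 < \<delta>" "\<delta> < 1" "\<delta> < d"
    using d(1) by (auto simp: \<delta>_def)
  have taylor: "\<phi> u \<le> k * (u - 1)\<^sup>2 \<and> k / 4 * (u - 1)\<^sup>2 \<le> \<phi> u" if u: "\<bar>u - 1\<bar> \<le> \<delta>" for u
  proof (cases "u = 1")
    case False
    define D where "D m = (if m = 0 then \<phi> else if m = Suc 0 then \<phi>1 else \<phi>2)" for m :: nat
    have D: "\<forall>m t. m < 2 \<and> 1 - \<delta> \<le> t \<and> t \<le> 1 + \<delta> \<longrightarrow> DERIV (D m) t :> D (Suc m) t"
      using \<delta> d1 d2 by (auto simp: D_def less_2_cases_iff)
    obtain t where t: "if u < 1 then u < t \<and> t < 1 else 1 < t \<and> t < u"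
      "\<phi> u = (\<Sum>m<2. D m 1 / fact m * (u - 1) ^ m) + D 2 t / fact 2 * (u - 1)\<^sup>2"
      using Taylor[of 2 D \<phi> "1 - \<delta>" "1 + \<delta>" 1 u, OF _ _ D] False u \<delta>
      by (auto simp: D_def abs_le_iff)
    have "\<phi> u = \<phi>2 t / 2 * (u - 1)\<^sup>2"
      using t(2) by (simp add: D_def at1 numeral_2_eq_2)
    moreover have "\<bar>\<phi>2 t - k\<bar> < k / 2"
      using t(1) u \<delta> by (intro d(2)) (auto split: if_splits)
    then have "\<phi>2 t / 2 \<le> k" "k / 4 \<le> \<phi>2 t / 2"
      using k by linarith+
    ultimately show ?thesis
      by (simp only:) (intro conjI mult_right_mono; simp)
  qed (simp add: at1)
  show thesis
  proof (rule that)
    show "0 < k / 4 * \<delta>" "0 < k" "0 < \<delta>"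
      using k \<delta> by auto
    show "\<phi> u \<le> k * (u - 1)\<^sup>2" if "\<bar>u - 1\<bar> < \<delta>" for u
      using taylor[of u] that by simp
    show "k / 4 * \<delta> * min ((u - 1)\<^sup>2) \<bar>u - 1\<bar> \<le> \<phi> u" if u: "0 < u" for u
    proof (cases "\<bar>u - 1\<bar> \<le> \<delta>")
      case True
      have "k / 4 * \<delta> * min ((u - 1)\<^sup>2) \<bar>u - 1\<bar> \<le> k / 4 * 1 * (u - 1)\<^sup>2"
        using k \<delta> by (intro mult_mono) auto
      then show ?thesis
        using taylor[OF True] by simp
    next
      case False
      define s where "s = \<delta> / \<bar>u - 1\<bar>"
      have s: "0 < s" "s \<le> 1" "s * \<bar>u - 1\<bar> = \<delta>"
        using False \<delta> by (auto simp: s_def)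
      \<comment> \<open>\<open>v\<close> lies on the segment from 1 to \<open>u\<close> at distance
        \<open>\<delta>\<close> from 1, where the Taylor bound still applies. Convexity carries
        \<open>k / 4 * \<delta>\<^sup>2\<close> over to \<open>s * \<phi> u\<close>, because
        \<open>\<phi>\<close> vanishes at 1.\<close>
      define v where "v = (1 - s) *\<^sub>R 1 + s *\<^sub>R u"
      have v: "v - 1 = s * (u - 1)"
        by (simp add: v_def algebra_simps)
      then have "\<bar>v - 1\<bar> = \<delta>"
        using s by (simp add: abs_mult)
      then have "k / 4 * \<delta>\<^sup>2 \<le> \<phi> v"
        using taylor[of v] by (metis order_refl power2_abs)
      also have "\<phi> v \<le> (1 - s) * \<phi> 1 + s * \<phi> u"
        unfolding v_def using u s by (intro convex_onD[OF conv]) auto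
      finally have "k / 4 * \<delta>\<^sup>2 \<le> s * \<phi> u"
        by (simp add: at1)
      then have "s * (k / 4 * \<delta> * \<bar>u - 1\<bar>) \<le> s * \<phi> u"
        using s(3) by (simp add: power2_eq_square mult.assoc mult.left_commute[of s] )
      then have "k / 4 * \<delta> * \<bar>u - 1\<bar> \<le> \<phi> u"
        using s(1) by simp
      moreover have "k / 4 * \<delta> * min ((u - 1)\<^sup>2) \<bar>u - 1\<bar> \<le> k / 4 * \<delta> * \<bar>u - 1\<bar>"
        using k \<delta> by (intro mult_left_mono) auto
      ultimately show ?thesis
        by linarith
    qed
  qed
qed

text \<open>For positive vectors none of the boundary conventions of \<open>d_phi\<close> is
  reached. The data enter this regime as soon as they are close to the strictly positive
  \<open>loglin_p W \<theta>0\<close>.\<close>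

lemma d_phi_pos:
  fixes p q :: "real^'m"
  assumes "\<And>r. 0 < p $ r" "\<And>r. 0 < q $ r"
  shows "d_phi \<phi> p q = ereal (\<Sum>r\<in>UNIV. q $ r * \<phi> (p $ r / q $ r))"
proof -
  have "q $ r \<noteq> 0" "0 < p $ r / q $ r" for r
    using assms[of r] by auto
  then show ?thesis
    by (simp add: d_phi_def phi_ext_def)
qed

lemma power2_norm_vec: "(norm (x :: real^'m))\<^sup>2 = (\<Sum>r\<in>UNIV. (x $ r)\<^sup>2)"
  unfolding power2_norm_eq_inner by (simp add: inner_vec_def power2_eq_square)

text \<open>Multiplication by \<open>q\<close> turns the minimum into the smaller of
  \<open>(p - q)\<^sup>2 / q\<close> and \<open>\<bar>p - q\<bar>\<close>, and both dominate
  \<open>(p - q)\<^sup>2\<close> for entries of at most 1. The constant does not depend on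
  \<open>q\<close>, so the bound survives model probabilities that approach 0.\<close>

lemma phi_term_lower:
  fixes p q :: real
  assumes phi: "\<And>u. 0 < u \<Longrightarrow> c * min ((u - 1)\<^sup>2) \<bar>u - 1\<bar> \<le> \<phi> u" and c: "0 < c"
    and p: "0 < p" "p \<le> 1" and q: "0 < q" "q \<le> 1"
  shows "c * (p - q)\<^sup>2 \<le> q * \<phi> (p / q)"
proof -
  have u: "p / q - 1 = (p - q) / q"
    using q by (simp add: field_simps)
  have "(p - q)\<^sup>2 \<le> \<bar>p - q\<bar>"
    using p q by (simp add: power2_eq_square abs_if mult_left_le_one_le mult_le_cancel_left1)
      (smt (verit) mult_left_le_one_le mult_minus_left mult_minus_right)
  moreover have "(p - q)\<^sup>2 \<le> (p - q)\<^sup>2 / q"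
    using q by (simp add: pos_le_divide_eq mult_left_le)
  moreover have "q * min ((p / q - 1)\<^sup>2) \<bar>p / q - 1\<bar> = min ((p - q)\<^sup>2 / q) \<bar>p - q\<bar>"
  proof -
    have "q * ((p - q) / q)\<^sup>2 = (p - q)\<^sup>2 / q" "q * \<bar>(p - q) / q\<bar> = \<bar>p - q\<bar>"
      using q by (simp_all add: power2_eq_square abs_divide)
    then show ?thesis
      unfolding u using q by (simp add: min_mult_distrib_left)
  qed
  ultimately have "(p - q)\<^sup>2 \<le> q * min ((p / q - 1)\<^sup>2) \<bar>p / q - 1\<bar>"
    by simp
  then have "c * (p - q)\<^sup>2 \<le> q * (c * min ((p / q - 1)\<^sup>2) \<bar>p / q - 1\<bar>)"
    using c by (simp add: mult.left_commute)
  also have "\<dots> \<le> q * \<phi> (p / q)"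
    using p q by (intro mult_left_mono phi) auto
  finally show ?thesis .
qed

section \<open>Expansion of the minimum divergence estimator\<close>

lemma d_phi_lower:
  fixes p q :: "real^'m"
  assumes phi: "\<And>u. 0 < u \<Longrightarrow> c * min ((u - 1)\<^sup>2) \<bar>u - 1\<bar> \<le> \<phi> u" and c: "0 < c"
    and p: "\<And>r. 0 < p $ r" "\<And>r. p $ r \<le> 1" and q: "\<And>r. 0 < q $ r" "\<And>r. q $ r \<le> 1"
  shows "ereal (c * (norm (p - q))\<^sup>2) \<le> d_phi \<phi> p q"
  unfolding d_phi_pos[OF p(1) q(1)] power2_norm_vec sum_distrib_left ereal_less_eq
  using phi_term_lower[OF phi c p q] by (intro sum_mono) simp

lemma d_phi_upper:
  fixes p q :: "real^'m"
  assumes phi: "\<And>u. \<bar>u - 1\<bar> < \<delta> \<Longrightarrow> \<phi> u \<le> K * (u - 1)\<^sup>2" and K: "0 < K"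
    and p: "\<And>r. 0 < p $ r" and q: "\<And>r. 0 < q $ r"
    and near: "\<And>r. \<bar>p $ r / q $ r - 1\<bar> < \<delta>"
  shows "d_phi \<phi> p q \<le> ereal (K * (\<Sum>r\<in>UNIV. 1 / q $ r) * (norm (p - q))\<^sup>2)"
  unfolding d_phi_pos[OF p q] power2_norm_vec sum_distrib_left ereal_less_eq
proof (rule sum_mono)
  fix r
  have "q $ r * \<phi> (p $ r / q $ r) \<le> q $ r * (K * (p $ r / q $ r - 1)\<^sup>2)"
    using phi[OF near[of r]] q[of r] by (simp add: mult_left_mono)
  also have "\<dots> = K * (1 / q $ r) * (p $ r - q $ r)\<^sup>2"
    using less_imp_neq[OF q[of r]] by (simp add: power2_eq_square field_simps)
  also have "\<dots> \<le> K * (\<Sum>r\<in>UNIV. 1 / q $ r) * (p $ r - q $ r)\<^sup>2"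
    using K q by (intro mult_right_mono mult_left_mono member_le_sum) (auto simp: less_imp_le)
  finally show "q $ r * \<phi> (p $ r / q $ r) \<le> (\<Sum>ra\<in>UNIV. K * (1 / q $ ra)) * ((p - q) $ r)\<^sup>2"
    by (simp add: sum_distrib_left)
qed

text \<open>The derivative of \<open>q * \<phi> (p / q)\<close> in \<open>q\<close> is
  \<open>\<phi> u - u * \<phi>1 u\<close> with \<open>u = p / q\<close>. The parameter ranges over
  the whole space, so a global minimum is interior and the gradient vanishes in every direction
  \<open>h\<close>.\<close>

lemma minimum_phi_stationary:
  fixes W :: "real^'k^'m" and p :: "real^'m"
  assumes d1: "\<And>u. u > 0 \<Longrightarrow> (\<phi> has_real_derivative \<phi>1 u) (at u)"
    and p: "\<And>r. 0 < p $ r"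
    and min: "\<And>\<theta>'. d_phi \<phi> p (loglin_p W \<theta>) \<le> d_phi \<phi> p (loglin_p W \<theta>')"
  defines "u \<equiv> \<lambda>r. p $ r / loglin_p W \<theta> $ r"
  shows "(\<Sum>r\<in>UNIV. (\<phi> (u r) - u r * \<phi>1 (u r)) * (Sigma_mat (loglin_p W \<theta>) *v (W *v h)) $ r) = 0"
proof -
  let ?f = "\<lambda>\<theta>. \<Sum>r\<in>UNIV. loglin_p W \<theta> $ r * \<phi> (p $ r / loglin_p W \<theta> $ r)"
  have D: "((\<lambda>\<theta>. loglin_p W \<theta> $ r * \<phi> (p $ r / loglin_p W \<theta> $ r)) has_derivative
     (\<lambda>h. (Sigma_mat (loglin_p W \<theta>) *v (W *v h)) $ r * (\<phi> (u r) - u r * \<phi>1 (u r)))) (at \<theta>)" for r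
  proof -
    have q: "0 < loglin_p W \<theta> $ r"
      by (rule loglin_p_pos)
    have "(\<phi> has_real_derivative \<phi>1 (u r)) (at (p $ r / loglin_p W \<theta> $ r))"
      using d1[of "u r"] q p[of r] by (simp add: u_def)
    then have "((\<lambda>q. q * \<phi> (p $ r / q)) has_real_derivative \<phi> (u r) - u r * \<phi>1 (u r)) (at (loglin_p W \<theta> $ r))"
      using q by (auto intro!: derivative_eq_intros DERIV_chain2[of \<phi>] simp: u_def field_simps power2_eq_square)
    moreover have "((\<lambda>\<theta>. loglin_p W \<theta> $ r) has_derivative (\<lambda>h. (Sigma_mat (loglin_p W \<theta>) *v (W *v h)) $ r)) (at \<theta>)"
      by (rule bounded_linear.has_derivative[OF bounded_linear_vec_nth has_derivative_loglin_p])
    ultimately show ?thesis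
      by (rule DERIV_compose_FDERIV)
  qed
  have "(?f has_derivative (\<lambda>h. \<Sum>r\<in>UNIV. (Sigma_mat (loglin_p W \<theta>) *v (W *v h)) $ r * (\<phi> (u r) - u r * \<phi>1 (u r)))) (at \<theta>)"
    by (rule has_derivative_sum) (rule D)
  moreover have "\<forall>\<theta>'. ?f \<theta> \<le> ?f \<theta>'"
    using min unfolding d_phi_pos[OF p loglin_p_pos] by simp
  then have "\<forall>\<^sub>F \<theta>' in at \<theta>. ?f \<theta> \<le> ?f \<theta>'"
    by (rule always_eventually)
  ultimately have "(\<lambda>h. \<Sum>r\<in>UNIV. (Sigma_mat (loglin_p W \<theta>) *v (W *v h)) $ r * (\<phi> (u r) - u r * \<phi>1 (u r))) = (\<lambda>h. 0)"
    by (rule has_derivative_local_min)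
  then show ?thesis
    by (simp add: fun_eq_iff mult.commute)
qed

text \<open>To first order, stationarity says that \<open>p - p(\<theta>)\<close> is orthogonal to the columns of \<open>W\<close>:
  \<open>\<phi>(u) - u \<phi>'(u) \<approx> - \<phi>''(1) (u - 1)\<close> for \<open>u = p / p(\<theta>)\<close>, and \<open>\<Sigma> D\<^sup>-\<^sup>1 (p - p(\<theta>)) = p - p(\<theta>)\<close>.
  Testing the stationarity equation in the direction \<open>W\<^sup>T (p - p(\<theta>))\<close> makes this quantitative.\<close>

lemma minimum_phi_almost_orthogonal:
  fixes W :: "real^'k^'m"
  assumes adm: "admissible_phi \<phi>" and e: "0 < e"
  obtains \<delta> where "0 < \<delta>"
    "\<And>p \<theta>. \<lbrakk>\<And>r. 0 < p $ r; (\<Sum>r\<in>UNIV. p $ r) = 1;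
       \<And>\<theta>'. d_phi \<phi> p (loglin_p W \<theta>) \<le> d_phi \<phi> p (loglin_p W \<theta>');
       \<And>r. \<bar>p $ r / loglin_p W \<theta> $ r - 1\<bar> < \<delta>\<rbrakk>
      \<Longrightarrow> norm (transpose W *v (p - loglin_p W \<theta>)) \<le> e * norm (p - loglin_p W \<theta>)"
proof -
  obtain \<phi>1 \<phi>2 where d1: "\<And>u. u > 0 \<Longrightarrow> (\<phi> has_real_derivative \<phi>1 u) (at u)"
    and d2: "\<And>u. u > 0 \<Longrightarrow> (\<phi>1 has_real_derivative \<phi>2 u) (at u)"
    and at1: "\<phi> 1 = 0" "\<phi>1 1 = 0" "\<phi>2 1 > 0"
    using adm unfolding admissible_phi_def by blast
  define k where "k = \<phi>2 1"
  have k: "0 < k"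
    using at1 by (simp add: k_def)
  obtain B where B: "0 < B" "\<And>y. norm (W *v y) \<le> B * norm y"
    using linear_bounded_pos[OF matrix_vector_mul_linear, of W] by auto
  \<comment> \<open>Divided out are the number of coordinates in the final sum, the factor 2 from
    centring \<open>x\<close> and the operator bound \<open>B\<close> of \<open>W\<close>; what they
    leave is \<open>e * k\<close>.\<close>
  define \<epsilon> where "\<epsilon> = e * k / (2 * CARD('m) * B)"
  have \<epsilon>: "0 < \<epsilon>"
    using e k B by (simp add: \<epsilon>_def)
  \<comment> \<open>The two contributions of \<open>\<phi>1 1\<close> cancel, leaving
    \<open>- \<phi>2 1\<close>. This linearises the stationarity equation around
    \<open>u = 1\<close>.\<close>
  have "((\<lambda>u. \<phi> u - u * \<phi>1 u) has_real_derivative - k) (at 1)"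
    using d1[of 1] d2[of 1] by (auto intro!: derivative_eq_intros simp: at1 k_def)
  then obtain \<delta> where \<delta>: "0 < \<delta>" "\<And>u. \<bar>u - 1\<bar> < \<delta> \<Longrightarrow> \<bar>\<phi> u - u * \<phi>1 u + k * (u - 1)\<bar> \<le> \<epsilon> * \<bar>u - 1\<bar>"
    unfolding has_field_derivative_def has_derivative_at_alt using \<epsilon> by (auto simp: at1)
  show thesis
  proof (rule that[OF \<delta>(1)])
    fix p :: "real^'m" and \<theta> :: "real^'k"
    assume p: "\<And>r. 0 < p $ r" and ps: "(\<Sum>r\<in>UNIV. p $ r) = 1"
      and min: "\<And>\<theta>'. d_phi \<phi> p (loglin_p W \<theta>) \<le> d_phi \<phi> p (loglin_p W \<theta>')"
      and near: "\<And>r. \<bar>p $ r / loglin_p W \<theta> $ r - 1\<bar> < \<delta>"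
    define q where "q = loglin_p W \<theta>"
    define u where "u = (\<lambda>r. p $ r / q $ r)"
    define y where "y = transpose W *v (p - q)"
    define x where "x = W *v y"
    define m where "m = (\<Sum>j\<in>UNIV. q $ j * x $ j)"
    have q: "0 < q $ r" for r
      by (simp add: q_def loglin_p_pos)
    have qs: "(\<Sum>r\<in>UNIV. q $ r) = 1"
      by (simp add: q_def loglin_p_sum)
    have uq: "(u r - 1) * (q $ r * z) = (p $ r - q $ r) * z" for r z
      using q[of r] by (simp add: u_def field_simps)
    have S: "(Sigma_mat q *v x) $ r = q $ r * (x $ r - m)" for r
      by (simp add: Sigma_mat_mult_nth m_def)
    have xm: "\<bar>x $ r - m\<bar> \<le> 2 * norm x" for r
    proof -
      have "\<bar>m\<bar> \<le> (\<Sum>j\<in>UNIV. q $ j * norm x)"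
        unfolding m_def using q
        by (intro order_trans[OF sum_abs] sum_mono) (simp add: abs_mult less_imp_le component_le_norm_cart)
      also have "\<dots> = norm x"
        by (simp add: qs flip: sum_distrib_right)
      finally show ?thesis
        using component_le_norm_cart[of x r] by linarith
    qed
    have stat: "(\<Sum>r\<in>UNIV. (\<phi> (u r) - u r * \<phi>1 (u r)) * (Sigma_mat q *v x) $ r) = 0"
      unfolding q_def u_def x_def by (rule minimum_phi_stationary[OF d1 p min])
    \<comment> \<open>The weights \<open>q $ r\<close> cancel the denominators of
      \<open>u r\<close>, and the centring constant \<open>m\<close> drops out because
      \<open>p\<close> and \<open>q\<close> have equal mass.\<close>
    have "(\<Sum>r\<in>UNIV. (u r - 1) * (Sigma_mat q *v x) $ r) = (\<Sum>r\<in>UNIV. (p $ r - q $ r) * x $ r) - m * (\<Sum>r\<in>UNIV. p $ r - q $ r)"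
      unfolding S uq by (simp add: sum_distrib_left sum_subtractf sum.distrib algebra_simps)
    also have "\<dots> = (p - q) \<bullet> x"
      by (simp add: sum_subtractf ps qs inner_vec_def)
    also have "\<dots> = y \<bullet> y"
      unfolding x_def y_def by (metis dot_lmul_matrix vector_transpose_matrix transpose_transpose)
    \<comment> \<open>The first sum is 0 by stationarity; adding it merges both sums into the
      linearisation error, which is small coordinate by coordinate.\<close>
    finally have "k * (norm y)\<^sup>2 = (\<Sum>r\<in>UNIV. (\<phi> (u r) - u r * \<phi>1 (u r)) * (Sigma_mat q *v x) $ r)
        + k * (\<Sum>r\<in>UNIV. (u r - 1) * (Sigma_mat q *v x) $ r)"
      by (simp add: stat power2_norm_eq_inner)
    also have "\<dots> = (\<Sum>r\<in>UNIV. (\<phi> (u r) - u r * \<phi>1 (u r) + k * (u r - 1)) * (Sigma_mat q *v x) $ r)"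
      unfolding sum_distrib_left sum.distrib[symmetric] by (simp add: algebra_simps)
    also have "\<dots> \<le> (\<Sum>r\<in>(UNIV :: 'm set). \<epsilon> * (norm (p - q) * (2 * (B * norm y))))"
    proof (rule sum_mono)
      fix r
      have "(\<phi> (u r) - u r * \<phi>1 (u r) + k * (u r - 1)) * (Sigma_mat q *v x) $ r
          \<le> \<bar>\<phi> (u r) - u r * \<phi>1 (u r) + k * (u r - 1)\<bar> * \<bar>(Sigma_mat q *v x) $ r\<bar>"
        unfolding abs_mult[symmetric] by (rule abs_ge_self)
      also have "\<dots> \<le> (\<epsilon> * \<bar>u r - 1\<bar>) * \<bar>(Sigma_mat q *v x) $ r\<bar>"
        using near[of r] by (intro mult_right_mono \<delta>(2)) (auto simp: u_def q_def)
      also have "\<dots> = \<epsilon> * \<bar>(u r - 1) * (q $ r * (x $ r - m))\<bar>"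
        unfolding S by (simp add: abs_mult)
      also have "\<dots> = \<epsilon> * (\<bar>(p - q) $ r\<bar> * \<bar>x $ r - m\<bar>)"
        unfolding uq by (simp add: abs_mult)
      also have "\<dots> \<le> \<epsilon> * (norm (p - q) * (2 * (B * norm y)))"
        using \<epsilon> xm[of r] B(2)[of y] by (intro mult_left_mono mult_mono component_le_norm_cart) (auto simp: x_def)
      finally show "(\<phi> (u r) - u r * \<phi>1 (u r) + k * (u r - 1)) * (Sigma_mat q *v x) $ r
          \<le> \<epsilon> * (norm (p - q) * (2 * (B * norm y)))" .
    qed
    also have "\<dots> = k * (e * norm (p - q) * norm y)"
      using B(1) by (simp add: \<epsilon>_def)
    finally have "norm y * norm y \<le> norm y * (e * norm (p - q))"
      using k by (simp add: power2_eq_square mult.commute)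
    then have "norm y \<le> e * norm (p - q)"
      using e by (cases "norm y = 0") (auto simp: mult_le_cancel_left_pos)
    then show "norm (transpose W *v (p - loglin_p W \<theta>)) \<le> e * norm (p - loglin_p W \<theta>)"
      by (simp add: y_def q_def)
  qed
qed

text \<open>When \<open>transpose W ** S ** W\<close> is invertible, this is the projection onto the
  kernel of \<open>transpose W\<close> along the range of \<open>S ** W\<close>: it removes the part
  of a deviation that the tangent space of the model explains.\<close>

definition residual_map :: "real^'k^'m \<Rightarrow> real^'m^'m \<Rightarrow> real^'m \<Rightarrow> real^'m" where
  "residual_map W S v =
     v - S *v (W *v (matrix_inv (transpose W ** S ** W) *v (transpose W *v v)))"

lemma linear_residual_map: "linear (residual_map W S)"
  by (rule linearI)
    (simp_all add: residual_map_def matrix_vector_right_distrib matrix_vector_mult_scaleR scaleR_diff_right)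

text \<open>The index \<open>x\<close> carries the data point and a minimiser separately, so
  \<open>T\<close> need not be a function of \<open>P\<close>. The deviation splits into
  \<open>P x - Q x\<close>, the linearisation error of the model and \<open>S *v (W *v h)\<close>;
  applying \<open>transpose W\<close> and inverting isolates \<open>h\<close>, while the first two
  parts contribute only errors.\<close>

lemma minimum_phi_expansion_filter:
  fixes W :: "real^'k^'m"
  assumes ind: "\<forall>c a. W *v c + a *\<^sub>R (1 :: real^'m) = 0 \<longrightarrow> c = 0 \<and> a = 0"
    and adm: "admissible_phi \<phi>"
    and P: "(P \<longlongrightarrow> loglin_p W \<theta>0) F"
    and Psum: "\<forall>\<^sub>F x in F. (\<Sum>r\<in>UNIV. P x $ r) = 1"
    and min: "\<forall>\<^sub>F x in F. \<forall>\<theta>. d_phi \<phi> (P x) (loglin_p W (T x)) \<le> d_phi \<phi> (P x) (loglin_p W \<theta>)"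
    and e: "0 < e"
  shows "\<forall>\<^sub>F x in F. norm (P x - loglin_p W (T x)
      - residual_map W (Sigma_mat (loglin_p W \<theta>0)) (P x - loglin_p W \<theta>0))
    \<le> e * norm (P x - loglin_p W \<theta>0)"
proof -
  define p0 where "p0 = loglin_p W \<theta>0"
  define S where "S = Sigma_mat p0"
  define V where "V = matrix_inv (transpose W ** S ** W)"
  define Q where "Q x = loglin_p W (T x)" for x
  have p0: "0 < p0 $ r" for r
    by (simp add: p0_def loglin_p_pos)
  have Q: "0 < Q x $ r" "Q x $ r \<le> 1" for x r
    by (simp_all add: Q_def loglin_p_pos loglin_p_le_1)
  note P = P[folded p0_def]
  have Ppos: "\<forall>\<^sub>F x in F. \<forall>r. 0 < P x $ r"
    using order_tendstoD(1)[OF tendsto_vec_nth[OF P] p0] by (intro eventually_all_finite)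
  obtain c K \<delta>0 where c: "0 < c" and K: "0 < K" and \<delta>0: "0 < \<delta>0"
    and lower: "\<And>u. 0 < u \<Longrightarrow> c * min ((u - 1)\<^sup>2) \<bar>u - 1\<bar> \<le> \<phi> u"
    and upper: "\<And>u. \<bar>u - 1\<bar> < \<delta>0 \<Longrightarrow> \<phi> u \<le> K * (u - 1)\<^sup>2"
    using admissible_phi_bounds[OF adm] by metis
  \<comment> \<open>Square root of the ratio between the upper constant of the divergence at
    \<open>p0\<close> and its global lower constant \<open>c\<close>.\<close>
  define C where "C = sqrt (K * (\<Sum>r\<in>UNIV. 1 / p0 $ r) / c)"
  have C: "0 \<le> C"
    using K c p0 by (simp add: C_def sum_nonneg less_imp_le)
  have near_p0: "\<forall>\<^sub>F x in F. \<forall>r. \<bar>P x $ r / p0 $ r - 1\<bar> < \<delta>0"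
  proof (intro eventually_all_finite)
    fix r
    have "((\<lambda>x. P x $ r / p0 $ r) \<longlongrightarrow> p0 $ r / p0 $ r) F"
      using p0[of r] by (intro tendsto_divide tendsto_vec_nth P tendsto_const) simp
    then show "\<forall>\<^sub>F x in F. \<bar>P x $ r / p0 $ r - 1\<bar> < \<delta>0"
      using tendstoD[OF _ \<delta>0] p0[of r] by (fastforce simp: dist_real_def)
  qed
  \<comment> \<open>The two bounds meet at the minimum, where the divergence is at most its value at
    \<open>p0\<close>. The lower bound is uniform over the model, so this yields consistency
    together with a rate.\<close>
  have PQ: "\<forall>\<^sub>F x in F. norm (P x - Q x) \<le> C * norm (P x - p0)"
    using Ppos Psum min near_p0
  proof eventually_elim
    case (elim x)
    have P1: "P x $ r \<le> 1" for r
      unfolding elim(2)[symmetric] using elim(1) by (intro member_le_sum) (auto simp: less_imp_le)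
    have "ereal (c * (norm (P x - Q x))\<^sup>2) \<le> d_phi \<phi> (P x) (Q x)"
      using elim(1) P1 Q by (intro d_phi_lower lower c) auto
    also have "\<dots> \<le> d_phi \<phi> (P x) p0"
      using elim(3) by (simp add: p0_def Q_def)
    also have "\<dots> \<le> ereal (K * (\<Sum>r\<in>UNIV. 1 / p0 $ r) * (norm (P x - p0))\<^sup>2)"
      using elim(1,4) p0 K by (intro d_phi_upper upper) auto
    finally have "(norm (P x - Q x))\<^sup>2 \<le> K * (\<Sum>r\<in>UNIV. 1 / p0 $ r) / c * (norm (P x - p0))\<^sup>2"
      using c by (simp add: field_simps)
    then have "sqrt ((norm (P x - Q x))\<^sup>2) \<le> sqrt (K * (\<Sum>r\<in>UNIV. 1 / p0 $ r) / c * (norm (P x - p0))\<^sup>2)"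
      by (rule real_sqrt_le_mono)
    then show ?case
      unfolding C_def real_sqrt_mult real_sqrt_abs by simp
  qed
  have P0: "((\<lambda>x. P x - p0) \<longlongrightarrow> 0) F"
    using P by (simp add: LIM_zero)
  have "((\<lambda>x. C * norm (P x - p0)) \<longlongrightarrow> 0) F"
    by (intro tendsto_mult_right_zero tendsto_norm_zero P0)
  with PQ have "((\<lambda>x. P x - Q x) \<longlongrightarrow> 0) F"
    by (rule Lim_null_comparison)
  then have "((\<lambda>x. P x - (P x - Q x)) \<longlongrightarrow> p0 - 0) F"
    by (intro tendsto_diff P)
  then have Qlim: "(Q \<longlongrightarrow> p0) F"
    by simp
  then have T: "(T \<longlongrightarrow> \<theta>0) F"
    unfolding Q_def p0_def by (rule loglin_p_inverse_tendsto[OF ind])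
  have inv: "invertible (transpose W ** S ** W)"
    unfolding S_def p0_def by (rule Fisher_information_invertible[OF ind])
  have inj: "inj (\<lambda>h. S *v (W *v h))"
  proof (rule injI)
    fix a b assume "S *v (W *v a) = S *v (W *v b)"
    then have "V *v ((transpose W ** S ** W) *v a) = V *v ((transpose W ** S ** W) *v b)"
      by (simp flip: matrix_vector_mul_assoc)
    then show "a = b"
      by (simp add: matrix_vector_mul_assoc V_def matrix_inv_inverse[OF inv])
  qed
  have linSW: "linear (\<lambda>h. S *v (W *v h))"
    by (rule linearI) (simp_all add: matrix_vector_right_distrib matrix_vector_mult_scaleR)
  obtain b where b: "0 < b" "\<And>h. b * norm h \<le> norm (S *v (W *v h))"
    using linear_inj_bounded_below_pos[OF linSW inj] by blast
  have deriv: "\<forall>\<^sub>F x in F. norm (Q x - p0 - S *v (W *v (T x - \<theta>0))) \<le> \<epsilon> * norm (T x - \<theta>0)" if "0 < \<epsilon>" for \<epsilon>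
  proof -
    obtain d where d: "0 < d" "\<And>\<theta>. norm (\<theta> - \<theta>0) < d \<Longrightarrow>
        norm (loglin_p W \<theta> - p0 - S *v (W *v (\<theta> - \<theta>0))) \<le> \<epsilon> * norm (\<theta> - \<theta>0)"
      using has_derivative_loglin_p[of W \<theta>0] \<open>0 < \<epsilon>\<close>
      unfolding has_derivative_at_alt S_def p0_def by blast
    show ?thesis
      using tendstoD[OF T d(1)] by eventually_elim (auto simp: Q_def dist_norm intro: d(2))
  qed
  \<comment> \<open>Half of \<open>b * norm (T x - \<theta>0)\<close> absorbs the linearisation
    error, taken with precision \<open>b / 2\<close>; the other half is at most
    \<open>norm (Q x - p0)\<close>, hence at most \<open>1 + C\<close> times the deviation of the
    data.\<close>
  define C' where "C' = 2 / b * (1 + C)"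
  have C': "0 < C'"
    using b C by (simp add: C'_def)
  have TP: "\<forall>\<^sub>F x in F. norm (T x - \<theta>0) \<le> C' * norm (P x - p0)"
    using deriv[OF half_gt_zero[OF b(1)]] PQ
  proof eventually_elim
    case (elim x)
    have "b * norm (T x - \<theta>0) \<le> norm (S *v (W *v (T x - \<theta>0)))"
      by (rule b)
    also have "\<dots> \<le> norm (Q x - p0) + norm (Q x - p0 - S *v (W *v (T x - \<theta>0)))"
      using norm_triangle_ineq4[of "Q x - p0" "Q x - p0 - S *v (W *v (T x - \<theta>0))"] by simp
    also have "\<dots> \<le> norm (Q x - p0) + b / 2 * norm (T x - \<theta>0)"
      using elim by simp
    finally have "b / 2 * norm (T x - \<theta>0) \<le> norm (Q x - p0)"
      by simp
    also have "\<dots> \<le> norm (P x - p0) + norm (P x - Q x)"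
      using norm_triangle_ineq4[of "P x - p0" "P x - Q x"] by simp
    also have "\<dots> \<le> (1 + C) * norm (P x - p0)"
      using elim by (simp add: algebra_simps)
    finally show ?case
      using b by (simp add: C'_def field_simps)
  qed
  have orth: "\<forall>\<^sub>F x in F. norm (transpose W *v (P x - Q x)) \<le> \<epsilon> * norm (P x - Q x)" if \<epsilon>: "0 < \<epsilon>" for \<epsilon>
  proof -
    obtain d where d: "0 < d" "\<And>p \<theta>. \<lbrakk>\<And>r. 0 < p $ r; (\<Sum>r\<in>UNIV. p $ r) = 1;
       \<And>\<theta>'. d_phi \<phi> p (loglin_p W \<theta>) \<le> d_phi \<phi> p (loglin_p W \<theta>');
       \<And>r. \<bar>p $ r / loglin_p W \<theta> $ r - 1\<bar> < d\<rbrakk>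
      \<Longrightarrow> norm (transpose W *v (p - loglin_p W \<theta>)) \<le> \<epsilon> * norm (p - loglin_p W \<theta>)"
      using minimum_phi_almost_orthogonal[OF adm \<epsilon>, of W] by metis
    have "\<forall>\<^sub>F x in F. \<forall>r. \<bar>P x $ r / Q x $ r - 1\<bar> < d"
    proof (intro eventually_all_finite)
      fix r
      have "((\<lambda>x. P x $ r / Q x $ r) \<longlongrightarrow> p0 $ r / p0 $ r) F"
        using p0[of r] by (intro tendsto_divide tendsto_vec_nth P Qlim) simp
      then show "\<forall>\<^sub>F x in F. \<bar>P x $ r / Q x $ r - 1\<bar> < d"
        using tendstoD[OF _ d(1)] p0[of r] by (fastforce simp: dist_real_def)
    qed
    then show ?thesis
      using Ppos Psum min
    proof eventually_elim
      case (elim x)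
      then show ?case
        unfolding Q_def by (intro d(2)) auto
    qed
  qed
  have lin1: "linear (\<lambda>z. S *v (W *v (V *v z)))"
    by (rule linearI) (simp_all add: matrix_vector_right_distrib matrix_vector_mult_scaleR)
  have lin2: "linear (\<lambda>z. S *v (W *v (V *v (transpose W *v z))))"
    by (rule linearI) (simp_all add: matrix_vector_right_distrib matrix_vector_mult_scaleR)
  obtain B1 where B1: "0 < B1" "\<And>z. norm (S *v (W *v (V *v z))) \<le> B1 * norm z"
    using linear_bounded_pos[OF lin1] by auto
  obtain B2 where B2: "0 < B2" "\<And>z. norm (S *v (W *v (V *v (transpose W *v z)))) \<le> B2 * norm z"
    using linear_bounded_pos[OF lin2] by auto
  \<comment> \<open>Each of the two errors gets \<open>e / 2\<close>. The 1 in \<open>B2 + 1\<close>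
    accounts for \<open>r1\<close> itself, which also occurs outside the linear map; in
    \<open>C + 1\<close> it keeps the divisor positive when \<open>C\<close> is 0.\<close>
  define \<epsilon>1 where "\<epsilon>1 = e / (2 * B1 * (C + 1))"
  define \<epsilon>2 where "\<epsilon>2 = e / (2 * (B2 + 1) * C')"
  have \<epsilon>: "0 < \<epsilon>1" "0 < \<epsilon>2"
    using e B1 B2 C C' by (auto simp: \<epsilon>1_def \<epsilon>2_def)
  show ?thesis
    unfolding p0_def[symmetric] S_def[symmetric] Q_def[symmetric]
    using orth[OF \<epsilon>(1)] deriv[OF \<epsilon>(2)] TP PQ
  proof eventually_elim
    case (elim x)
    define h where "h = T x - \<theta>0"
    define r1 where "r1 = Q x - p0 - S *v (W *v h)"
    define r2 where "r2 = transpose W *v (P x - Q x)"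
    have "transpose W *v (P x - p0) = r2 + transpose W *v r1 + (transpose W ** S ** W) *v h"
      unfolding r1_def r2_def
      by (simp add: matrix_vector_mult_diff_distrib algebra_simps flip: matrix_vector_mul_assoc)
    then have "V *v (transpose W *v (P x - p0)) = V *v r2 + V *v (transpose W *v r1) + h"
      by (simp add: matrix_vector_right_distrib matrix_vector_mul_assoc V_def matrix_inv_inverse[OF inv])
    then have expand: "S *v (W *v (V *v (transpose W *v (P x - p0)))) =
        S *v (W *v (V *v r2)) + S *v (W *v (V *v (transpose W *v r1))) + S *v (W *v h)"
      by (simp only: matrix_vector_right_distrib)
    have Sh: "S *v (W *v h) = Q x - p0 - r1"
      by (simp add: r1_def)
    have eq: "P x - Q x - residual_map W S (P x - p0) =
        S *v (W *v (V *v r2)) + S *v (W *v (V *v (transpose W *v r1))) - r1"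
      unfolding residual_map_def V_def[symmetric] expand Sh by simp
    have "norm (P x - Q x - residual_map W S (P x - p0)) \<le>
        norm (S *v (W *v (V *v r2))) + norm (S *v (W *v (V *v (transpose W *v r1)))) + norm r1"
      unfolding eq using norm_triangle_ineq4[of "S *v (W *v (V *v r2)) + S *v (W *v (V *v (transpose W *v r1)))" r1]
        norm_triangle_ineq[of "S *v (W *v (V *v r2))" "S *v (W *v (V *v (transpose W *v r1)))"] by linarith
    also have "\<dots> \<le> B1 * norm r2 + (B2 + 1) * norm r1"
      using B1(2)[of r2] B2(2)[of r1] by (simp add: algebra_simps)
    also have "\<dots> \<le> B1 * (\<epsilon>1 * ((C + 1) * norm (P x - p0))) + (B2 + 1) * (\<epsilon>2 * (C' * norm (P x - p0)))"
    proof (intro add_mono mult_left_mono)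
      have "norm r2 \<le> \<epsilon>1 * norm (P x - Q x)"
        using elim(1) by (simp add: r2_def)
      also have "\<dots> \<le> \<epsilon>1 * ((C + 1) * norm (P x - p0))"
      proof (rule mult_left_mono)
        show "norm (P x - Q x) \<le> (C + 1) * norm (P x - p0)"
          using elim(4) norm_ge_zero[of "P x - p0"] unfolding distrib_right by linarith
      qed (use \<epsilon> in simp)
      finally show "norm r2 \<le> \<epsilon>1 * ((C + 1) * norm (P x - p0))" .
      have "norm r1 \<le> \<epsilon>2 * norm h"
        using elim(2) by (simp add: r1_def h_def)
      also have "\<dots> \<le> \<epsilon>2 * (C' * norm (P x - p0))"
        using elim(3) \<epsilon> by (intro mult_left_mono) (auto simp: h_def)
      finally show "norm r1 \<le> \<epsilon>2 * (C' * norm (P x - p0))" .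
    qed (use B1 B2 in auto)
    also have "\<dots> = e * norm (P x - p0)"
    proof -
      have "B1 * (\<epsilon>1 * (C + 1)) = e / 2" "(B2 + 1) * (\<epsilon>2 * C') = e / 2"
      proof -
        have ne: "C + 1 \<noteq> 0" "B2 + 1 \<noteq> 0" "B1 \<noteq> 0" "C' \<noteq> 0"
          using C B1(1) B2(1) C' by linarith+
        have cancel: "x * (e / (2 * x * y) * y) = e / 2" if "x \<noteq> 0" "y \<noteq> 0" for x y
          using that by simp
        show "B1 * (\<epsilon>1 * (C + 1)) = e / 2" "(B2 + 1) * (\<epsilon>2 * C') = e / 2"
          unfolding \<epsilon>1_def \<epsilon>2_def by (rule cancel[OF ne(3,1)], rule cancel[OF ne(2,4)])
      qed
      then have "B1 * (\<epsilon>1 * (C + 1)) * norm (P x - p0) + (B2 + 1) * (\<epsilon>2 * C') * norm (P x - p0) = e * norm (P x - p0)"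
        by (simp only: field_sum_of_halves flip: distrib_right)
      then show ?thesis
        by (simp add: mult.assoc)
    qed
    finally show ?case .
  qed
qed

text \<open>The filter consists of pairs whose first entry tends to
  \<open>loglin_p W \<theta>0\<close> and whose second entry minimises the divergence. It converts
  the limit statement into a single radius for all such pairs, which can then be applied to every
  outcome separately.\<close>

lemma minimum_phi_expansion:
  fixes W :: "real^'k^'m"
  assumes ind: "\<forall>c a. W *v c + a *\<^sub>R (1 :: real^'m) = 0 \<longrightarrow> c = 0 \<and> a = 0"
    and adm: "admissible_phi \<phi>" and e: "0 < e"
  obtains \<delta> where "0 < \<delta>"
    "\<And>p \<theta>. \<lbrakk>(\<Sum>r\<in>UNIV. p $ r) = 1; norm (p - loglin_p W \<theta>0) < \<delta>;
       \<And>\<theta>'. d_phi \<phi> p (loglin_p W \<theta>) \<le> d_phi \<phi> p (loglin_p W \<theta>')\<rbrakk>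
      \<Longrightarrow> norm (p - loglin_p W \<theta>
            - residual_map W (Sigma_mat (loglin_p W \<theta>0)) (p - loglin_p W \<theta>0))
          \<le> e * norm (p - loglin_p W \<theta>0)"
proof -
  define A where "A = {(p, \<theta>). (\<Sum>r\<in>UNIV. p $ r) = 1 \<and>
    (\<forall>\<theta>'. d_phi \<phi> p (loglin_p W \<theta>) \<le> d_phi \<phi> p (loglin_p W \<theta>'))}"
  define F where "F = inf (filtercomap fst (nhds (loglin_p W \<theta>0))) (principal A)"
  have "\<forall>\<^sub>F x in F. norm (fst x - loglin_p W (snd x)
      - residual_map W (Sigma_mat (loglin_p W \<theta>0)) (fst x - loglin_p W \<theta>0))
    \<le> e * norm (fst x - loglin_p W \<theta>0)"
  proof (rule minimum_phi_expansion_filter[OF ind adm _ _ _ e])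
    show "(fst \<longlongrightarrow> loglin_p W \<theta>0) F"
      unfolding F_def by (rule filterlim_mono[OF filterlim_filtercomap]) auto
  qed (auto simp: F_def eventually_inf_principal A_def intro!: always_eventually)
  then obtain N where N: "\<forall>\<^sub>F p in nhds (loglin_p W \<theta>0). N p" "\<forall>x. N (fst x) \<longrightarrow> x \<in> A \<longrightarrow>
      norm (fst x - loglin_p W (snd x) - residual_map W (Sigma_mat (loglin_p W \<theta>0)) (fst x - loglin_p W \<theta>0))
      \<le> e * norm (fst x - loglin_p W \<theta>0)"
    unfolding F_def eventually_inf_principal eventually_filtercomap by blast
  obtain \<delta> where "0 < \<delta>" "\<And>p. dist p (loglin_p W \<theta>0) < \<delta> \<Longrightarrow> N p"
    using N(1) unfolding eventually_nhds_metric by blast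
  then show thesis
    using N(2) by (intro that[of \<delta>]) (simp_all add: dist_norm A_def)
qed

section \<open>Asymptotic normality\<close>

lemma (in prob_space) second_moment_sum_indep:
  fixes X :: "'i \<Rightarrow> 'a \<Rightarrow> real"
  assumes I: "finite I" and ind: "indep_vars (\<lambda>_. borel) X I"
    and b: "\<And>i \<omega>. i \<in> I \<Longrightarrow> \<omega> \<in> space M \<Longrightarrow> \<bar>X i \<omega>\<bar> \<le> b"
    and mean: "\<And>i. i \<in> I \<Longrightarrow> expectation (X i) = 0"
  shows "expectation (\<lambda>\<omega>. (\<Sum>i\<in>I. X i \<omega>)\<^sup>2) = (\<Sum>i\<in>I. expectation (\<lambda>\<omega>. (X i \<omega>)\<^sup>2))"
proof -
  have rv: "X i \<in> borel_measurable M" if "i \<in> I" for i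
    using ind that by (auto simp: indep_vars_def)
  have int: "integrable M (X i)" if "i \<in> I" for i
    by (rule integrable_const_bound[of _ b]) (use b that rv in auto)
  have int2: "integrable M (\<lambda>\<omega>. X i \<omega> * X j \<omega>)" if "i \<in> I" "j \<in> I" for i j
  proof (rule integrable_const_bound[of _ "b * b"])
    show "AE \<omega> in M. norm (X i \<omega> * X j \<omega>) \<le> b * b"
    proof (rule AE_I2)
      fix \<omega> assume "\<omega> \<in> space M"
      then show "norm (X i \<omega> * X j \<omega>) \<le> b * b"
        using b[of i \<omega>] b[of j \<omega>] that by (auto simp: abs_mult intro!: mult_mono order_trans[OF abs_ge_zero])
    qed
    show "(\<lambda>\<omega>. X i \<omega> * X j \<omega>) \<in> borel_measurable M"
      using rv that by auto
  qed
  have cross: "expectation (\<lambda>\<omega>. X i \<omega> * X j \<omega>) = (if i = j then expectation (\<lambda>\<omega>. (X i \<omega>)\<^sup>2) else 0)"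
    if ij: "i \<in> I" "j \<in> I" for i j
  proof (cases "i = j")
    case False
    have "expectation (\<lambda>\<omega>. \<Prod>k\<in>{i, j}. X k \<omega>) = (\<Prod>k\<in>{i, j}. expectation (X k))"
      using ij int by (intro indep_vars_lebesgue_integral indep_vars_subset[OF ind]) auto
    then show ?thesis
      using False ij mean by simp
  qed (simp add: power2_eq_square)
  have "expectation (\<lambda>\<omega>. (\<Sum>i\<in>I. X i \<omega>)\<^sup>2) = expectation (\<lambda>\<omega>. \<Sum>i\<in>I. \<Sum>j\<in>I. X i \<omega> * X j \<omega>)"
    by (simp add: power2_eq_square sum_product)
  also have "\<dots> = (\<Sum>i\<in>I. \<Sum>j\<in>I. expectation (\<lambda>\<omega>. X i \<omega> * X j \<omega>))"
    by (simp add: int2)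
  also have "\<dots> = (\<Sum>i\<in>I. expectation (\<lambda>\<omega>. (X i \<omega>)\<^sup>2))"
    using I by (intro sum.cong refl) (simp add: cross)
  finally show ?thesis .
qed

text \<open>One row of a triangular array. Clusters of different sizes have covariances that are
  multiples of one matrix, so a scalar \<open>\<kappa> i\<close> per summand is enough and only the
  sum of these scalars matters in the limit.\<close>

locale centered_bounded_sum = prob_space M for M :: "'a measure" +
  fixes I :: "'i set" and U :: "'i \<Rightarrow> 'a \<Rightarrow> real^'m" and \<kappa> :: "'i \<Rightarrow> real" and S :: "real^'m^'m" and b :: real
  assumes finite_I: "finite I"
    and indep: "indep_vars (\<lambda>_. borel) U I"
    and bound: "\<And>i \<omega>. i \<in> I \<Longrightarrow> \<omega> \<in> space M \<Longrightarrow> norm (U i \<omega>) \<le> b"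
    and mean: "\<And>i r. i \<in> I \<Longrightarrow> expectation (\<lambda>\<omega>. U i \<omega> $ r) = 0"
    and cov: "\<And>i r s. i \<in> I \<Longrightarrow> expectation (\<lambda>\<omega>. U i \<omega> $ r * U i \<omega> $ s) = \<kappa> i * S $ r $ s"
begin

lemma U_measurable: "i \<in> I \<Longrightarrow> U i \<in> borel_measurable M"
  using indep by (auto simp: indep_vars_def)

lemma U_nth_measurable: "i \<in> I \<Longrightarrow> (\<lambda>\<omega>. U i \<omega> $ r) \<in> borel_measurable M"
  using measurable_compose[OF U_measurable, of i "\<lambda>x. x $ r"]
  by (simp add: borel_measurable_continuous_onI continuous_intros)

lemma U_nth_bound: "i \<in> I \<Longrightarrow> \<omega> \<in> space M \<Longrightarrow> \<bar>U i \<omega> $ r\<bar> \<le> b"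
  using component_le_norm_cart[of "U i \<omega>" r] bound[of i \<omega>] by linarith

lemma inner_bound: "i \<in> I \<Longrightarrow> \<omega> \<in> space M \<Longrightarrow> \<bar>a \<bullet> U i \<omega>\<bar> \<le> norm a * b"
  using Cauchy_Schwarz_ineq2[of a "U i \<omega>"] mult_left_mono[OF bound norm_ge_zero[of a], of i \<omega>]
  by linarith

lemma indep_inner: "indep_vars (\<lambda>_. borel) (\<lambda>i \<omega>. a \<bullet> U i \<omega>) I"
  by (rule indep_vars_compose2[OF indep]) simp

lemma integrable_nth: "i \<in> I \<Longrightarrow> integrable M (\<lambda>\<omega>. U i \<omega> $ r)"
  by (rule integrable_const_bound[of _ b]) (auto simp: U_nth_bound U_nth_measurable)

lemma integrable_nth_mult: "i \<in> I \<Longrightarrow> integrable M (\<lambda>\<omega>. U i \<omega> $ r * U i \<omega> $ s)"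
proof (rule integrable_const_bound[of _ "b * b"])
  assume i: "i \<in> I"
  show "AE \<omega> in M. norm (U i \<omega> $ r * U i \<omega> $ s) \<le> b * b"
  proof (rule AE_I2)
    fix \<omega> assume "\<omega> \<in> space M"
    then show "norm (U i \<omega> $ r * U i \<omega> $ s) \<le> b * b"
      using U_nth_bound[OF i, of \<omega>]
      by (auto simp: abs_mult intro!: mult_mono order_trans[OF abs_ge_zero])
  qed
  show "(\<lambda>\<omega>. U i \<omega> $ r * U i \<omega> $ s) \<in> borel_measurable M"
    by (intro borel_measurable_times U_nth_measurable i)
qed

lemma mean_inner: "i \<in> I \<Longrightarrow> expectation (\<lambda>\<omega>. a \<bullet> U i \<omega>) = 0"
  by (simp add: inner_vec_def integrable_nth mean)

lemma second_moment_inner: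
  assumes "i \<in> I"
  shows "expectation (\<lambda>\<omega>. (a \<bullet> U i \<omega>)\<^sup>2) = \<kappa> i * (a \<bullet> (S *v a))"
proof -
  have "expectation (\<lambda>\<omega>. (a \<bullet> U i \<omega>)\<^sup>2) =
      expectation (\<lambda>\<omega>. \<Sum>r\<in>UNIV. \<Sum>s\<in>UNIV. a $ r * a $ s * (U i \<omega> $ r * U i \<omega> $ s))"
    by (simp add: power2_eq_square inner_vec_def sum_product mult.assoc mult.left_commute)
  also have "\<dots> = (\<Sum>r\<in>UNIV. \<Sum>s\<in>UNIV. a $ r * a $ s * (\<kappa> i * S $ r $ s))"
    by (simp add: integrable_nth_mult[OF assms] cov[OF assms])
  also have "\<dots> = \<kappa> i * (a \<bullet> (S *v a))"
    by (simp add: inner_vec_def matrix_vector_mult_def sum_distrib_left algebra_simps)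
  finally show ?thesis .
qed

lemma charfun_approx:
  "cmod (expectation (\<lambda>\<omega>. cis (a \<bullet> (\<Sum>i\<in>I. U i \<omega>))) -
      complex_of_real (exp (- ((\<Sum>i\<in>I. \<kappa> i) * (a \<bullet> (S *v a))) / 2)))
    \<le> card I * ((norm a * b) ^ 3 / 6 + (norm a * b) ^ 4 / 8)"
  using char_sum_bounded_approx[OF finite_I indep_inner[of a] inner_bound mean_inner second_moment_inner]
  by (simp add: inner_sum_right sum_distrib_right)

text \<open>Independence removes the cross terms in each coordinate, and summing the coordinates
  produces the trace. Through Chebyshev's inequality this is the source of tightness.\<close>

lemma second_moment_norm:
  "expectation (\<lambda>\<omega>. (norm (\<Sum>i\<in>I. U i \<omega>))\<^sup>2) = (\<Sum>i\<in>I. \<kappa> i) * (\<Sum>r\<in>UNIV. S $ r $ r)"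
  and integrable_norm2: "integrable M (\<lambda>\<omega>. (norm (\<Sum>i\<in>I. U i \<omega>))\<^sup>2)"
proof -
  have int: "integrable M (\<lambda>\<omega>. ((\<Sum>i\<in>I. U i \<omega>) $ r)\<^sup>2)" for r
  proof (rule integrable_const_bound[of _ "(card I * b)\<^sup>2"])
    have "\<bar>(\<Sum>i\<in>I. U i \<omega>) $ r\<bar> \<le> card I * b" if "\<omega> \<in> space M" for \<omega>
      using that by (auto intro!: order_trans[OF sum_abs] sum_bounded_above simp: U_nth_bound)
    then show "AE \<omega> in M. norm (((\<Sum>i\<in>I. U i \<omega>) $ r)\<^sup>2) \<le> (card I * b)\<^sup>2"
      by (intro AE_I2) (metis abs_ge_zero norm_power power_mono real_norm_def)
    show "(\<lambda>\<omega>. ((\<Sum>i\<in>I. U i \<omega>) $ r)\<^sup>2) \<in> borel_measurable M"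
      by (simp, intro borel_measurable_power borel_measurable_sum U_nth_measurable)
  qed
  have "expectation (\<lambda>\<omega>. ((\<Sum>i\<in>I. U i \<omega>) $ r)\<^sup>2) = (\<Sum>i\<in>I. \<kappa> i) * S $ r $ r" for r
  proof -
    have "expectation (\<lambda>\<omega>. (\<Sum>i\<in>I. axis r 1 \<bullet> U i \<omega>)\<^sup>2) = (\<Sum>i\<in>I. expectation (\<lambda>\<omega>. (axis r 1 \<bullet> U i \<omega>)\<^sup>2))"
      by (rule second_moment_sum_indep[OF finite_I indep_inner inner_bound mean_inner])
    then show ?thesis
      by (simp add: inner_axis' power2_eq_square cov sum_distrib_right)
  qed
  then show "expectation (\<lambda>\<omega>. (norm (\<Sum>i\<in>I. U i \<omega>))\<^sup>2) = (\<Sum>i\<in>I. \<kappa> i) * (\<Sum>r\<in>UNIV. S $ r $ r)"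
    unfolding power2_norm_vec using int by (simp add: sum_distrib_left)
  show "integrable M (\<lambda>\<omega>. (norm (\<Sum>i\<in>I. U i \<omega>))\<^sup>2)"
    unfolding power2_norm_vec using int by simp
qed

end

section \<open>Tail control and transfer through an asymptotically linear map\<close>

lemma (in prob_space) Chebyshev_norm:
  fixes X :: "'a \<Rightarrow> 'b::real_normed_vector"
  assumes int: "integrable M (\<lambda>\<omega>. (norm (X \<omega>))\<^sup>2)" and R: "0 < R"
  shows "measure M {\<omega> \<in> space M. R \<le> norm (X \<omega>)} \<le> expectation (\<lambda>\<omega>. (norm (X \<omega>))\<^sup>2) / R\<^sup>2"
proof -
  have "{\<omega> \<in> space M. R \<le> norm (X \<omega>)} = {\<omega> \<in> space M. R\<^sup>2 \<le> (norm (X \<omega>))\<^sup>2}"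
    using R by (auto simp: abs_le_square_iff[symmetric])
  then show ?thesis
    using integral_Markov_inequality_measure[OF int, of "space M" "R\<^sup>2"] R by simp
qed

text \<open>Slutsky's lemma and the continuous mapping theorem in one step: where \<open>X\<close>
  is below \<open>R\<close> the two exponentials differ by at most the difference of their phases,
  elsewhere by at most 2 on a set of small probability. The hypothesis \<open>approx\<close> is
  pointwise on the event that \<open>X\<close> is bounded, the form in which a deterministic
  expansion delivers it.\<close>

theorem conv_in_law_approx_linear:
  fixes A :: "real^'m \<Rightarrow> real^'n" and Mv :: "nat \<Rightarrow> 'a measure"
  assumes prob: "\<And>\<nu>. prob_space (Mv \<nu>)"
    and X[measurable]: "\<And>\<nu>. X \<nu> \<in> borel_measurable (Mv \<nu>)"
    and V[measurable]: "\<And>\<nu>. V \<nu> \<in> borel_measurable (Mv \<nu>)"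
    and A: "linear A"
    and char_X: "\<And>a. (\<lambda>\<nu>. \<integral>\<omega>. cis (a \<bullet> X \<nu> \<omega>) \<partial>Mv \<nu>) \<longlonglongrightarrow> \<psi> a"
    and tight_X: "\<And>e. 0 < e \<Longrightarrow>
      \<exists>R>0. \<forall>\<^sub>F \<nu> in sequentially. measure (Mv \<nu>) {\<omega> \<in> space (Mv \<nu>). R \<le> norm (X \<nu> \<omega>)} \<le> e"
    and approx: "\<And>R \<eta>. 0 < R \<Longrightarrow> 0 < \<eta> \<Longrightarrow> \<forall>\<^sub>F \<nu> in sequentially.
      \<forall>\<omega>\<in>space (Mv \<nu>). norm (X \<nu> \<omega>) < R \<longrightarrow> norm (V \<nu> \<omega> - A (X \<nu> \<omega>)) \<le> \<eta>"
    and \<mu>: "prob_space \<mu>" "sets \<mu> = sets borel"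
    and char_\<mu>: "\<And>t. (\<integral>x. cis (t \<bullet> x) \<partial>\<mu>) = \<psi> (adjoint A t)"
  shows "conv_in_law (\<lambda>\<nu>. distr (Mv \<nu>) borel (V \<nu>)) \<mu>"
proof (rule conv_in_law_charfun[OF _ _ \<mu>])
  show "prob_space (distr (Mv \<nu>) borel (V \<nu>))" for \<nu>
    by (rule prob_space.prob_space_distr[OF prob V])
  show "sets (distr (Mv \<nu>) borel (V \<nu>)) = sets borel" for \<nu>
    by simp
  have A_cont: "continuous_on UNIV A"
    using A linear_continuous_on linear_linear by blast
  have AX[measurable]: "(\<lambda>\<omega>. A (X \<nu> \<omega>)) \<in> borel_measurable (Mv \<nu>)" for \<nu>
    by (rule measurable_compose[OF X borel_measurable_continuous_onI[OF A_cont]])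
  have cis_m: "(\<lambda>x. cis (t \<bullet> x)) \<in> borel_measurable borel" for t :: "real^'n"
    unfolding cis_conv_exp by measurable
  show "(\<lambda>\<nu>. \<integral>x. cis (t \<bullet> x) \<partial>distr (Mv \<nu>) borel (V \<nu>)) \<longlonglongrightarrow> (\<integral>x. cis (t \<bullet> x) \<partial>\<mu>)" for t
  proof -
    define E where "E \<nu> = (\<integral>\<omega>. cis (t \<bullet> V \<nu> \<omega>) \<partial>Mv \<nu>) - (\<integral>\<omega>. cis (t \<bullet> A (X \<nu> \<omega>)) \<partial>Mv \<nu>)" for \<nu>
    have "E \<longlonglongrightarrow> 0"
    proof (rule tendstoI)
      fix e :: real assume e: "0 < e"
      obtain R where R: "0 < R" and
        tail: "\<forall>\<^sub>F \<nu> in sequentially. measure (Mv \<nu>) {\<omega> \<in> space (Mv \<nu>). R \<le> norm (X \<nu> \<omega>)} \<le> e / 6"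
        using tight_X[of "e / 6"] e by auto
      \<comment> \<open>With tail probability at most \<open>e / 6\<close> the two errors are at
        most \<open>e / 3\<close> each, which leaves a strict inequality. The added 1 in the
        denominator covers \<open>t = 0\<close>.\<close>
      define \<eta> where "\<eta> = e / (3 * (norm t + 1))"
      have t1: "0 < norm t + 1"
        by (simp add: add_nonneg_pos)
      have \<eta>: "0 < \<eta>" "norm t * \<eta> \<le> e / 3"
        using e t1 by (auto simp: \<eta>_def field_simps)
      from tail approx[OF R \<eta>(1)] show "\<forall>\<^sub>F \<nu> in sequentially. dist (E \<nu>) 0 < e"
      proof eventually_elim
        case (elim \<nu>)
        interpret prob_space "Mv \<nu>" by (rule prob)
        let ?far = "{\<omega> \<in> space (Mv \<nu>). R \<le> norm (X \<nu> \<omega>)}"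
        have far: "?far \<in> sets (Mv \<nu>)"
          by measurable
        have i1: "integrable (Mv \<nu>) (\<lambda>\<omega>. cis (t \<bullet> V \<nu> \<omega>))"
          by (rule integrable_const_bound[of _ 1]) (auto intro: measurable_compose[OF V cis_m])
        have i2: "integrable (Mv \<nu>) (\<lambda>\<omega>. cis (t \<bullet> A (X \<nu> \<omega>)))"
          by (rule integrable_const_bound[of _ 1]) (auto intro: measurable_compose[OF AX cis_m])
        have pw: "cmod (cis (t \<bullet> V \<nu> \<omega>) - cis (t \<bullet> A (X \<nu> \<omega>))) \<le> e / 3 + 2 * indicator ?far \<omega>"
          if \<omega>: "\<omega> \<in> space (Mv \<nu>)" for \<omega>
        proof (cases "\<omega> \<in> ?far")
          case True
          have "cmod (cis (t \<bullet> V \<nu> \<omega>) - cis (t \<bullet> A (X \<nu> \<omega>))) \<le> 1 + 1"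
            by (rule order_trans[OF norm_triangle_ineq4]) simp
          then show ?thesis
            using True e by simp
        next
          case False
          have "cmod (cis (t \<bullet> V \<nu> \<omega>) - cis (t \<bullet> A (X \<nu> \<omega>))) \<le> \<bar>t \<bullet> V \<nu> \<omega> - t \<bullet> A (X \<nu> \<omega>)\<bar>"
          proof -
            have "cis (t \<bullet> V \<nu> \<omega>) - cis (t \<bullet> A (X \<nu> \<omega>)) =
                cis (t \<bullet> A (X \<nu> \<omega>)) * (cis (t \<bullet> V \<nu> \<omega> - t \<bullet> A (X \<nu> \<omega>)) - 1)"
              by (simp add: algebra_simps cis_mult)
            then have "cmod (cis (t \<bullet> V \<nu> \<omega>) - cis (t \<bullet> A (X \<nu> \<omega>))) =
                cmod (cis (t \<bullet> V \<nu> \<omega> - t \<bullet> A (X \<nu> \<omega>)) - 1)"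
              by (simp add: norm_mult)
            also have "\<dots> \<le> \<bar>t \<bullet> V \<nu> \<omega> - t \<bullet> A (X \<nu> \<omega>)\<bar>"
              using iexp_approx1[of "t \<bullet> V \<nu> \<omega> - t \<bullet> A (X \<nu> \<omega>)" 0] by (simp add: cis_conv_exp)
            finally show ?thesis .
          qed
          also have "\<dots> \<le> norm t * norm (V \<nu> \<omega> - A (X \<nu> \<omega>))"
            unfolding inner_diff_right[symmetric] by (rule Cauchy_Schwarz_ineq2)
          also have "\<dots> \<le> norm t * \<eta>"
            using elim(2) \<omega> False by (intro mult_left_mono) auto
          also have "\<dots> \<le> e / 3"
            by (rule \<eta>)
          finally show ?thesis
            using False by simp
        qed
        have "cmod (E \<nu>) = cmod (\<integral>\<omega>. cis (t \<bullet> V \<nu> \<omega>) - cis (t \<bullet> A (X \<nu> \<omega>)) \<partial>Mv \<nu>)"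
          unfolding E_def by (simp only: Bochner_Integration.integral_diff[OF i1 i2])
        also have "\<dots> \<le> (\<integral>\<omega>. cmod (cis (t \<bullet> V \<nu> \<omega>) - cis (t \<bullet> A (X \<nu> \<omega>))) \<partial>Mv \<nu>)"
          by (rule integral_norm_bound)
        also have "\<dots> \<le> (\<integral>\<omega>. e / 3 + 2 * indicator ?far \<omega> \<partial>Mv \<nu>)"
        proof (rule integral_mono)
          show "integrable (Mv \<nu>) (\<lambda>\<omega>. cmod (cis (t \<bullet> V \<nu> \<omega>) - cis (t \<bullet> A (X \<nu> \<omega>))))"
            by (rule integrable_norm, rule Bochner_Integration.integrable_diff[OF i1 i2])
          show "integrable (Mv \<nu>) (\<lambda>\<omega>. e / 3 + 2 * indicator ?far \<omega>)"
            using far by (simp add: emeasure_eq_measure)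
        qed (rule pw)
        also have "\<dots> = e / 3 + 2 * measure (Mv \<nu>) ?far"
          using far by (simp add: emeasure_eq_measure prob_space)
        also have "\<dots> < e"
          using elim(1) e by linarith
        finally show ?case
          by simp
      qed
    qed
    moreover have "(\<lambda>\<nu>. \<integral>\<omega>. cis (t \<bullet> A (X \<nu> \<omega>)) \<partial>Mv \<nu>) \<longlonglongrightarrow> \<psi> (adjoint A t)"
    proof -
      have "t \<bullet> A x = adjoint A t \<bullet> x" for x
        using adjoint_works[OF A, of x t] by (simp add: inner_commute)
      then show ?thesis
        using char_X[of "adjoint A t"] by simp
    qed
    ultimately have "(\<lambda>\<nu>. E \<nu> + (\<integral>\<omega>. cis (t \<bullet> A (X \<nu> \<omega>)) \<partial>Mv \<nu>)) \<longlonglongrightarrow> 0 + \<psi> (adjoint A t)"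
      by (rule tendsto_add)
    then show ?thesis
      by (simp add: E_def char_\<mu> integral_distr[OF V cis_m])
  qed
  show "\<exists>R. \<forall>\<^sub>F \<nu> in sequentially. measure (distr (Mv \<nu>) borel (V \<nu>)) {x. R < norm x} \<le> e" if e: "0 < e" for e
  proof -
    obtain R where R: "0 < R" and
      tail: "\<forall>\<^sub>F \<nu> in sequentially. measure (Mv \<nu>) {\<omega> \<in> space (Mv \<nu>). R \<le> norm (X \<nu> \<omega>)} \<le> e"
      using tight_X[OF e] by auto
    obtain B where B: "0 < B" "\<And>x. norm (A x) \<le> B * norm x"
      using linear_bounded_pos[OF A] by auto
    \<comment> \<open>Precision 1 is enough for tightness: off the tail event \<open>V\<close> is
      within 1 of the image of \<open>X\<close>, whose norm is at most \<open>B * R\<close>.\<close>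
    from tail approx[OF R zero_less_one]
    have "\<forall>\<^sub>F \<nu> in sequentially. measure (distr (Mv \<nu>) borel (V \<nu>)) {x. B * R + 1 < norm x} \<le> e"
    proof eventually_elim
      case (elim \<nu>)
      interpret prob_space "Mv \<nu>" by (rule prob)
      have S: "{x :: real^'n. B * R + 1 < norm x} \<in> sets borel"
        by (intro borel_open open_Collect_less continuous_intros)
      have "norm (V \<nu> \<omega>) \<le> B * R + 1" if "\<omega> \<in> space (Mv \<nu>)" "norm (X \<nu> \<omega>) < R" for \<omega>
      proof -
        have "norm (V \<nu> \<omega>) \<le> norm (A (X \<nu> \<omega>)) + norm (V \<nu> \<omega> - A (X \<nu> \<omega>))"
          by (metis norm_triangle_sub)
        moreover have "norm (A (X \<nu> \<omega>)) \<le> B * R"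
          using B(2)[of "X \<nu> \<omega>"] mult_left_mono[of "norm (X \<nu> \<omega>)" R B] B(1) that by linarith
        ultimately show ?thesis
          using elim(2) that by fastforce
      qed
      then have "V \<nu> -` {x. B * R + 1 < norm x} \<inter> space (Mv \<nu>) \<subseteq> {\<omega> \<in> space (Mv \<nu>). R \<le> norm (X \<nu> \<omega>)}"
        by (auto simp: not_le[symmetric])
      then have "measure (Mv \<nu>) (V \<nu> -` {x. B * R + 1 < norm x} \<inter> space (Mv \<nu>))
          \<le> measure (Mv \<nu>) {\<omega> \<in> space (Mv \<nu>). R \<le> norm (X \<nu> \<omega>)}"
        by (rule finite_measure_mono) measurable
      then show ?case
        using elim(1) by (simp add: measure_distr[OF V S])
    qed
    then show ?thesis
      by blast
  qed
qed

section \<open>Covariance of the projected limit\<close>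

lemma inner_matrix_transpose: "x \<bullet> (A *v y) = (transpose A *v x) \<bullet> (y :: real^'n)"
  by (simp add: dot_lmul_matrix)

text \<open>The adjoint sends \<open>t\<close> to \<open>t - W *v d\<close>, and both the cross term
  and the square of \<open>W *v d\<close> in the form of \<open>S\<close> equal
  \<open>d \<bullet> y\<close>. The sandwich therefore collapses to one correction, as in
  Pythagoras' identity for the \<open>S\<close>-orthogonal complement of the range of
  \<open>W\<close>.\<close>

lemma residual_quadratic_form:
  fixes W :: "real^'k^'m"
  assumes sym: "\<And>x y. x \<bullet> (S *v y) = (S *v x) \<bullet> y"
    and inv: "invertible (transpose W ** S ** W)"
  shows "adjoint (residual_map W S) t \<bullet> (S *v adjoint (residual_map W S) t) =
    t \<bullet> ((S - S ** W ** matrix_inv (transpose W ** S ** W) ** transpose W ** S) *v t)"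
proof -
  define M where "M = transpose W ** S ** W"
  define V where "V = matrix_inv M"
  define y where "y = transpose W *v (S *v t)"
  define d where "d = transpose V *v y"
  have "adjoint (residual_map W S) = (\<lambda>t. t - W *v (transpose V *v (transpose W *v (S *v t))))"
  proof (intro adjoint_unique allI)
    fix x y
    have "(S *v (W *v (V *v (transpose W *v x)))) \<bullet> y = x \<bullet> (W *v (transpose V *v (transpose W *v (S *v y))))"
      by (simp only: inner_matrix_transpose[of _ W] inner_matrix_transpose[of _ "transpose V"] transpose_transpose)
        (metis inner_commute inner_matrix_transpose sym)
    then show "residual_map W S x \<bullet> y = x \<bullet> (y - W *v (transpose V *v (transpose W *v (S *v y))))"
      unfolding residual_map_def M_def[symmetric] V_def[symmetric]
      by (simp add: inner_diff_left inner_diff_right del: transpose_matrix_vector)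
  qed
  then have adj: "adjoint (residual_map W S) t = t - W *v d"
    by (simp add: d_def y_def del: transpose_matrix_vector)
  have "transpose S = S"
    using sym by (metis inner_commute inner_matrix_transpose matrix_eq vector_eq_rdot)
  \<comment> \<open>The adjoint produces \<open>transpose V\<close>; symmetry of \<open>M\<close>
    makes it a right inverse of \<open>M\<close> too, so symmetry of \<open>V\<close> itself never
    has to be shown.\<close>
  then have "transpose M = M"
    by (simp add: M_def matrix_transpose_mul matrix_mul_assoc)
  then have "M ** transpose V = transpose (V ** M)"
    by (simp add: matrix_transpose_mul)
  then have MV: "M ** transpose V = mat 1"
    using matrix_inv_inverse[OF inv] by (simp add: V_def M_def transpose_mat)
  have 1: "(W *v d) \<bullet> (S *v t) = d \<bullet> y"
    unfolding y_def by (metis inner_commute inner_matrix_transpose)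
  have "(W *v d) \<bullet> (S *v (W *v d)) = d \<bullet> (M *v d)"
    unfolding M_def matrix_vector_mul_assoc[symmetric]
    by (metis inner_commute inner_matrix_transpose)
  also have "M *v d = y"
    by (simp add: d_def matrix_vector_mul_assoc MV del: transpose_matrix_vector)
  finally have 2: "(W *v d) \<bullet> (S *v (W *v d)) = d \<bullet> y" .
  have "(t - W *v d) \<bullet> (S *v (t - W *v d)) = t \<bullet> (S *v t) - 2 * ((W *v d) \<bullet> (S *v t)) + (W *v d) \<bullet> (S *v (W *v d))"
    by (simp add: matrix_vector_mult_diff_distrib inner_diff_left inner_diff_right sym[of t "W *v d"] inner_commute)
  also have "\<dots> = t \<bullet> (S *v t) - y \<bullet> (V *v y)"
    using inner_matrix_transpose[of y V y] by (simp add: 1 2 del: transpose_matrix_vector flip: d_def)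
  also have "y \<bullet> (V *v y) = t \<bullet> (S *v (W *v (V *v y)))"
    unfolding y_def by (metis inner_matrix_transpose sym)
  finally show ?thesis
    unfolding adj M_def[symmetric] V_def[symmetric] y_def
    by (simp add: matrix_vector_mult_diff_rdistrib inner_diff_right del: transpose_matrix_vector
        flip: matrix_vector_mul_assoc)
qed

text \<open>The matrix \<open>diag (sqrt p)\<close> times the centring map: an explicit factor of
  \<open>Sigma_mat p\<close> that takes the place of a spectral square root when the Gaussian law is
  built.\<close>

definition Sigma_root :: "real^'m \<Rightarrow> real^'m \<Rightarrow> real^'m" where
  "Sigma_root p a = (\<chi> r. sqrt (p $ r) * (a $ r - (\<Sum>s\<in>UNIV. p $ s * a $ s)))"

lemma linear_Sigma_root: "linear (Sigma_root p)"
  by (rule linearI)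
    (auto simp: Sigma_root_def vec_eq_iff algebra_simps sum.distrib sum_distrib_left)

lemma norm_Sigma_root:
  assumes p: "\<And>r. 0 \<le> p $ r" and sum: "(\<Sum>r\<in>UNIV. p $ r) = 1"
  shows "(norm (Sigma_root p a))\<^sup>2 = a \<bullet> (Sigma_mat p *v a)"
  unfolding Sigma_mat_quadratic_form[OF sum]
  by (simp add: power2_norm_vec Sigma_root_def power_mult_distrib p)

section \<open>Normal limit for clusters of unequal size\<close>

theorem theorem5:
  fixes W :: "real^'k^'m" and \<theta>0 :: "real^'k" and \<phi> :: "real \<Rightarrow> real"
    and G :: nat and n :: "nat \<Rightarrow> nat" and Nstar :: "nat \<Rightarrow> real" and rho2 :: real
    and Nc :: "nat \<Rightarrow> nat \<Rightarrow> nat"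
    and Mv :: "nat \<Rightarrow> 'a measure"
    and Y :: "nat \<Rightarrow> nat \<Rightarrow> nat \<Rightarrow> 'a \<Rightarrow> real^'m"
    and thetahat :: "nat \<Rightarrow> 'a \<Rightarrow> real^'k"
  defines "Ntot \<equiv> (\<lambda>\<nu>. \<Sum>g<G. Nc \<nu> g)"
    and "vartheta \<equiv> (\<lambda>m::real. 1 + (m - 1) * rho2)"
    and "phat \<equiv> (\<lambda>\<nu> \<omega>. (1 / real (\<Sum>h<G. n h * Nc \<nu> h)) *\<^sub>R
                          (\<Sum>g<G. \<Sum>l<Nc \<nu> g. Y \<nu> g l \<omega>))"
    and "nbar \<equiv> (\<Sum>g<G. Nstar g * real (n g))"
    and "nstar \<equiv> (\<Sum>g<G. (Nstar g * real (n g) / (\<Sum>h<G. Nstar h * real (n h))) * real (n g))"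
    and "S0 \<equiv> Sigma_mat (loglin_p W \<theta>0)"
  assumes M_ge3: "CARD('m) \<ge> 3"
    and M0_lt: "1 \<le> CARD('k)" "CARD('k) < CARD('m) - 1"
    and W_full_rank: "\<forall>c. W *v c = 0 \<longrightarrow> c = 0"
    and W_one_indep: "\<forall>c a. W *v c + a *\<^sub>R (1 :: real^'m) = 0 \<longrightarrow> c = 0 \<and> a = 0"
    and phi_adm: "admissible_phi \<phi>"
    and G_pos: "G \<ge> 1"
    and n_ge2: "\<forall>g<G. n g \<ge> 2"
    and n_distinct: "inj_on n {..<G}"
    and rho2_nonneg: "rho2 \<ge> 0"
    and Nstar_range: "\<forall>g<G. 0 < Nstar g \<and> Nstar g \<le> 1"
    and N_to_inf: "filterlim (\<lambda>\<nu>. Ntot \<nu>) at_top sequentially"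
    and N_ratio: "\<forall>g<G. (\<lambda>\<nu>. real (Nc \<nu> g) / real (Ntot \<nu>)) \<longlonglongrightarrow> Nstar g"
    and prob: "\<forall>\<nu>. prob_space (Mv \<nu>)"
    and Y_meas: "\<forall>\<nu> g l. g < G \<longrightarrow> l < Nc \<nu> g \<longrightarrow> Y \<nu> g l \<in> borel_measurable (Mv \<nu>)"
    and Y_indep: "\<forall>\<nu>. prob_space.indep_vars (Mv \<nu>) (\<lambda>_. borel) (\<lambda>(g, l). Y \<nu> g l)
                          {(g, l). g < G \<and> l < Nc \<nu> g}"
    and Y_ident: "\<forall>\<nu> g l l'. g < G \<longrightarrow> l < Nc \<nu> g \<longrightarrow> l' < Nc \<nu> g \<longrightarrow>
                    distr (Mv \<nu>) borel (Y \<nu> g l) = distr (Mv \<nu>) borel (Y \<nu> g l')"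
    and Y_values: "\<forall>\<nu> g l. g < G \<longrightarrow> l < Nc \<nu> g \<longrightarrow> (\<forall>\<omega>\<in>space (Mv \<nu>).
                    (\<forall>r. Y \<nu> g l \<omega> $ r \<in> \<nat>) \<and> (\<Sum>r\<in>UNIV. Y \<nu> g l \<omega> $ r) = real (n g))"
    and Y_mean: "\<forall>\<nu> g l r. g < G \<longrightarrow> l < Nc \<nu> g \<longrightarrow>
                    (\<integral>\<omega>. Y \<nu> g l \<omega> $ r \<partial>Mv \<nu>) = real (n g) * loglin_p W \<theta>0 $ r"
    and Y_var: "\<forall>\<nu> g l r s. g < G \<longrightarrow> l < Nc \<nu> g \<longrightarrow>
                    (\<integral>\<omega>. (Y \<nu> g l \<omega> $ r - real (n g) * loglin_p W \<theta>0 $ r) *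
                          (Y \<nu> g l \<omega> $ s - real (n g) * loglin_p W \<theta>0 $ s) \<partial>Mv \<nu>)
                    = vartheta (real (n g)) * real (n g) * S0 $ r $ s"
    and thetahat_meas: "\<forall>\<nu>. thetahat \<nu> \<in> borel_measurable (Mv \<nu>)"
    and thetahat_min: "\<forall>\<nu>. \<forall>\<omega>\<in>space (Mv \<nu>). \<forall>\<theta>.
                    d_phi \<phi> (phat \<nu> \<omega>) (loglin_p W (thetahat \<nu> \<omega>))
                      \<le> d_phi \<phi> (phat \<nu> \<omega>) (loglin_p W \<theta>)"
  shows "\<exists>\<mu>. is_centered_mvn
              ((vartheta nstar / nbar) *\<^sub>R
                 (S0 - S0 ** W ** matrix_inv (transpose W ** S0 ** W) ** transpose W ** S0)) \<mu>
           \<and> conv_in_law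
              (\<lambda>\<nu>. distr (Mv \<nu>) borel
                     (\<lambda>\<omega>. sqrt (real (Ntot \<nu>)) *\<^sub>R (phat \<nu> \<omega> - loglin_p W (thetahat \<nu> \<omega>))))
              \<mu>"
proof -
  define p0 where "p0 = loglin_p W \<theta>0"
  define N where "N \<nu> = real (Ntot \<nu>)" for \<nu>
  define D where "D \<nu> = real (\<Sum>h<G. n h * Nc \<nu> h)" for \<nu>
  \<comment> \<open>\<open>D \<nu>\<close> is the total number of observations, so this scaling
    turns the sum of the centred clusters into \<open>sqrt (N \<nu>)\<close> times the deviation of
    \<open>phat\<close>.\<close>
  define c where "c \<nu> = sqrt (N \<nu>) / D \<nu>" for \<nu>
  define I where "I \<nu> = Sigma {..<G} (\<lambda>g. {..<Nc \<nu> g})" for \<nu>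
  define U where "U \<nu> = (\<lambda>(g, l) \<omega>. c \<nu> *\<^sub>R (Y \<nu> g l \<omega> - real (n g) *\<^sub>R p0))" for \<nu>
  define X where "X \<nu> \<omega> = (\<Sum>i\<in>I \<nu>. U \<nu> i \<omega>)" for \<nu> \<omega>
  define V where "V \<nu> \<omega> = sqrt (N \<nu>) *\<^sub>R (phat \<nu> \<omega> - loglin_p W (thetahat \<nu> \<omega>))" for \<nu> \<omega>
  define \<kappa> where "\<kappa> \<nu> = (\<lambda>(g, l::nat). (c \<nu>)\<^sup>2 * (vartheta (real (n g)) * real (n g)))" for \<nu>
  \<comment> \<open>A crude bound common to all groups and all \<open>\<nu>\<close>: each coordinate
    of a centred cluster is at most the sum of the group sizes in absolute value, and the norm is at
    most the sum over the coordinates.\<close>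
  define Kb where "Kb = real CARD('m) * real (\<Sum>h<G. n h)"
  define K where "K = vartheta nstar / nbar"

  have p0: "0 < p0 $ r" "p0 $ r \<le> 1" for r
    by (simp_all add: p0_def loglin_p_pos loglin_p_le_1)
  have S0: "S0 = Sigma_mat p0"
    by (simp add: S0_def p0_def)
  have nbar_pos: "0 < nbar"
    unfolding nbar_def using G_pos n_ge2 Nstar_range
    by (intro sum_pos) (auto simp: lessThan_empty_iff intro!: mult_pos_pos)
  have finite_I: "finite (I \<nu>)" for \<nu>
    by (simp add: I_def)
  have card_I: "real (card (I \<nu>)) = N \<nu>" for \<nu>
    by (simp add: I_def N_def Ntot_def)
  have I_eq: "I \<nu> = {(g, l). g < G \<and> l < Nc \<nu> g}" for \<nu>
    by (auto simp: I_def)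
  have sum_I: "(\<Sum>g<G. \<Sum>l<Nc \<nu> g. f g l) = (\<Sum>(g, l)\<in>I \<nu>. f g l)" for \<nu> and f :: "nat \<Rightarrow> nat \<Rightarrow> 'z::comm_monoid_add"
    unfolding I_def by (rule sum.Sigma) auto
  have c_nonneg: "0 \<le> c \<nu>" for \<nu>
    unfolding c_def N_def D_def by (intro divide_nonneg_nonneg real_sqrt_ge_zero of_nat_0_le_iff)

  have N_lim: "filterlim N at_top sequentially"
    unfolding N_def using filterlim_compose[OF filterlim_real_sequentially N_to_inf] .
  have sqrtN_lim: "filterlim (\<lambda>\<nu>. sqrt (N \<nu>)) at_top sequentially"
    by (rule filterlim_compose[OF sqrt_at_top N_lim])
  have "(\<lambda>\<nu>. \<Sum>g<G. real (n g) * (real (Nc \<nu> g) / N \<nu>)) \<longlonglongrightarrow> (\<Sum>g<G. real (n g) * Nstar g)"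
    using N_ratio by (intro tendsto_sum tendsto_mult tendsto_const) (auto simp: N_def)
  then have "(\<lambda>\<nu>. D \<nu> / N \<nu>) \<longlonglongrightarrow> nbar"
    by (simp add: D_def nbar_def sum_divide_distrib mult.commute)
  then have "(\<lambda>\<nu>. inverse (D \<nu> / N \<nu>)) \<longlonglongrightarrow> inverse nbar"
    using nbar_pos by (intro tendsto_inverse) auto
  then have ND_lim: "(\<lambda>\<nu>. N \<nu> / D \<nu>) \<longlonglongrightarrow> inverse nbar"
    by (simp add: inverse_eq_divide)
  have c_eq: "c \<nu> = N \<nu> / D \<nu> * inverse (sqrt (N \<nu>))" for \<nu>
    using real_div_sqrt[of "N \<nu>"] by (simp add: c_def N_def field_simps)
  have "c \<longlonglongrightarrow> inverse nbar * 0"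
    unfolding c_eq by (intro tendsto_mult ND_lim tendsto_inverse_0_at_top sqrtN_lim)
  then have c_lim: "c \<longlonglongrightarrow> 0"
    by simp
  have Nc2: "N \<nu> * (c \<nu>)\<^sup>2 = (N \<nu> / D \<nu>)\<^sup>2" for \<nu>
    by (simp add: c_def N_def power_divide) (simp add: power2_eq_square)
  have Nc2_lim: "(\<lambda>\<nu>. N \<nu> * (c \<nu>)\<^sup>2) \<longlonglongrightarrow> (inverse nbar)\<^sup>2"
    unfolding Nc2 by (intro tendsto_power ND_lim)
  \<comment> \<open>\<open>vartheta\<close> is affine and \<open>nstar\<close> is the mean size
    under weights proportional to \<open>Nstar g * n g\<close>, so averaging \<open>vartheta\<close>
    with these weights evaluates it at \<open>nstar\<close>. The factor
    \<open>(inverse nbar)\<^sup>2\<close> is the limit of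
    \<open>N \<nu> * (c \<nu>)\<^sup>2\<close>.\<close>
  have K_eq: "K = (\<Sum>g<G. Nstar g * (vartheta (real (n g)) * real (n g))) * (inverse nbar)\<^sup>2"
  proof -
    have "nbar * nstar = (\<Sum>g<G. Nstar g * real (n g) * real (n g))"
      unfolding nstar_def nbar_def[symmetric] sum_distrib_left using nbar_pos by simp
    then have "(\<Sum>g<G. Nstar g * (vartheta (real (n g)) * real (n g))) = nbar + (nbar * nstar - nbar) * rho2"
      unfolding vartheta_def nbar_def
      by (simp add: algebra_simps sum.distrib sum_subtractf sum_distrib_left)
    also have "\<dots> = nbar * vartheta nstar"
      by (simp add: vartheta_def algebra_simps)
    finally show ?thesis
      using nbar_pos by (simp add: K_def power2_eq_square divide_inverse)
  qed
  have K_nonneg: "0 \<le> K"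
    unfolding K_eq vartheta_def using Nstar_range rho2_nonneg n_ge2
    by (intro mult_nonneg_nonneg sum_nonneg add_nonneg_nonneg) (force intro: less_imp_le)+
  have sum_\<kappa>: "(\<Sum>i\<in>I \<nu>. \<kappa> \<nu> i) =
      (\<Sum>g<G. real (Nc \<nu> g) / N \<nu> * (vartheta (real (n g)) * real (n g))) * (N \<nu> * (c \<nu>)\<^sup>2)" for \<nu>
  \<comment> \<open>For an empty sample \<open>c \<nu>\<close> is 0 and both sides vanish; otherwise
    the factor \<open>N \<nu>\<close> cancels.\<close>
  proof (cases "N \<nu> = 0")
    case True
    then show ?thesis
      by (simp add: \<kappa>_def c_def case_prod_unfold)
  next
    case False
    have "(\<Sum>i\<in>I \<nu>. \<kappa> \<nu> i) = (\<Sum>g<G. \<Sum>l<Nc \<nu> g. (c \<nu>)\<^sup>2 * (vartheta (real (n g)) * real (n g)))"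
      unfolding sum_I \<kappa>_def ..
    also have "\<dots> = (\<Sum>g<G. real (Nc \<nu> g) / N \<nu> * (vartheta (real (n g)) * real (n g))) * (N \<nu> * (c \<nu>)\<^sup>2)"
      unfolding sum_distrib_right using False by (intro sum.cong) auto
    finally show ?thesis .
  qed
  have \<kappa>_lim: "(\<lambda>\<nu>. \<Sum>i\<in>I \<nu>. \<kappa> \<nu> i) \<longlonglongrightarrow> K"
    unfolding sum_\<kappa> K_eq using N_ratio
    by (intro tendsto_mult tendsto_sum Nc2_lim tendsto_const) (auto simp: N_def)

  have Y_bounds: "0 \<le> Y \<nu> g l \<omega> $ r" "Y \<nu> g l \<omega> $ r \<le> real (n g)"
    if gl: "g < G" "l < Nc \<nu> g" and \<omega>: "\<omega> \<in> space (Mv \<nu>)" for \<nu> g l \<omega> r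
  proof -
    have nn: "0 \<le> Y \<nu> g l \<omega> $ r" for r
      using Y_values gl \<omega> by (metis Nats_cases of_nat_0_le_iff)
    then show "0 \<le> Y \<nu> g l \<omega> $ r" .
    have "Y \<nu> g l \<omega> $ r \<le> (\<Sum>r\<in>UNIV. Y \<nu> g l \<omega> $ r)"
      using nn by (intro member_le_sum) auto
    then show "Y \<nu> g l \<omega> $ r \<le> real (n g)"
      using Y_values gl \<omega> by auto
  qed
  have Y_norm: "norm (Y \<nu> g l \<omega> - real (n g) *\<^sub>R p0) \<le> Kb"
    if gl: "g < G" "l < Nc \<nu> g" and \<omega>: "\<omega> \<in> space (Mv \<nu>)" for \<nu> g l \<omega>
  proof -
    have "norm (Y \<nu> g l \<omega> - real (n g) *\<^sub>R p0) \<le> (\<Sum>r\<in>UNIV. \<bar>(Y \<nu> g l \<omega> - real (n g) *\<^sub>R p0) $ r\<bar>)"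
      by (rule norm_le_l1_cart)
    also have "\<dots> \<le> (\<Sum>r\<in>(UNIV :: 'm set). real (\<Sum>h<G. n h))"
    proof (rule sum_mono)
      fix r
      have "0 \<le> real (n g) * p0 $ r" "real (n g) * p0 $ r \<le> real (n g)"
        using p0[of r] by (auto simp: mult_left_le)
      moreover have "n g \<le> (\<Sum>h<G. n h)"
        using gl by (intro member_le_sum) auto
      then have "real (n g) \<le> real (\<Sum>h<G. n h)"
        by (simp only: of_nat_le_iff)
      ultimately show "\<bar>(Y \<nu> g l \<omega> - real (n g) *\<^sub>R p0) $ r\<bar> \<le> real (\<Sum>h<G. n h)"
        using Y_bounds[OF gl \<omega>, of r]
        unfolding vector_minus_component vector_scaleR_component real_scaleR_def by linarith
    qed
    also have "\<dots> = Kb"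
      by (simp add: Kb_def)
    finally show ?thesis .
  qed
  have Y_nth_meas: "(\<lambda>\<omega>. Y \<nu> g l \<omega> $ r) \<in> borel_measurable (Mv \<nu>)" if "g < G" "l < Nc \<nu> g" for \<nu> g l r
    using that Y_meas by (intro measurable_compose[of "Y \<nu> g l" _ borel "\<lambda>x. x $ r"])
      (auto intro!: borel_measurable_continuous_onI continuous_intros)

  have sums: "centered_bounded_sum (Mv \<nu>) (I \<nu>) (U \<nu>) (\<kappa> \<nu>) S0 (c \<nu> * Kb)" for \<nu>
  proof -
    interpret prob_space "Mv \<nu>"
      using prob by simp
    show ?thesis
    proof
      show "finite (I \<nu>)"
        by (rule finite_I)
      have "indep_vars (\<lambda>_. borel) (\<lambda>i \<omega>. c \<nu> *\<^sub>R ((case i of (g, l) \<Rightarrow> Y \<nu> g l) \<omega> - real (n (fst i)) *\<^sub>R p0)) (I \<nu>)"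
        unfolding I_eq using Y_indep by (intro indep_vars_compose2[where Y = "\<lambda>i y. c \<nu> *\<^sub>R (y - real (n (fst i)) *\<^sub>R p0)"]) auto
      then show "indep_vars (\<lambda>_. borel) (U \<nu>) (I \<nu>)"
        by (simp add: U_def case_prod_unfold)
    next
      fix i \<omega> assume "i \<in> I \<nu>" "\<omega> \<in> space (Mv \<nu>)"
      then show "norm (U \<nu> i \<omega>) \<le> c \<nu> * Kb"
        using Y_norm c_nonneg[of \<nu>] by (auto simp: U_def I_def intro!: mult_left_mono)
    next
      fix i r assume "i \<in> I \<nu>"
      then obtain g l where i: "i = (g, l)" and gl: "g < G" "l < Nc \<nu> g"
        by (auto simp: I_def)
      have "integrable (Mv \<nu>) (\<lambda>\<omega>. Y \<nu> g l \<omega> $ r)"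
        using Y_bounds[OF gl] by (intro integrable_const_bound[of _ "real (n g)"] Y_nth_meas gl) auto
      then show "expectation (\<lambda>\<omega>. U \<nu> i \<omega> $ r) = 0"
        using Y_mean gl by (simp add: i U_def p0_def prob_space)
    next
      fix i r s assume "i \<in> I \<nu>"
      then obtain g l where i: "i = (g, l)" and gl: "g < G" "l < Nc \<nu> g"
        by (auto simp: I_def)
      have "expectation (\<lambda>\<omega>. U \<nu> i \<omega> $ r * U \<nu> i \<omega> $ s) =
        expectation (\<lambda>\<omega>. (c \<nu>)\<^sup>2 * ((Y \<nu> g l \<omega> $ r - real (n g) * loglin_p W \<theta>0 $ r) * (Y \<nu> g l \<omega> $ s - real (n g) * loglin_p W \<theta>0 $ s)))"
        by (simp add: i U_def p0_def power2_eq_square mult.assoc mult.left_commute)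
      also have "\<dots> = (c \<nu>)\<^sup>2 * (vartheta (real (n g)) * real (n g) * S0 $ r $ s)"
        using Y_var gl by simp
      finally show "expectation (\<lambda>\<omega>. U \<nu> i \<omega> $ r * U \<nu> i \<omega> $ s) = \<kappa> \<nu> i * S0 $ r $ s"
        by (simp add: i \<kappa>_def)
    qed
  qed

  have char_X: "(\<lambda>\<nu>. \<integral>\<omega>. cis (a \<bullet> X \<nu> \<omega>) \<partial>Mv \<nu>) \<longlonglongrightarrow> complex_of_real (exp (- (K * (a \<bullet> (S0 *v a))) / 2))" for a
  proof -
    let ?E = "\<lambda>\<nu>. (\<integral>\<omega>. cis (a \<bullet> X \<nu> \<omega>) \<partial>Mv \<nu>)"
    let ?L = "\<lambda>\<nu>. complex_of_real (exp (- ((\<Sum>i\<in>I \<nu>. \<kappa> \<nu> i) * (a \<bullet> (S0 *v a))) / 2))"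
    \<comment> \<open>In the error bound \<open>N \<nu> * (c \<nu>)\<^sup>2\<close> converges, and
      every remaining term keeps at least one power of \<open>c \<nu>\<close>, which forces the
      limit 0.\<close>
    have bnd: "cmod (?E \<nu> - ?L \<nu>) \<le> N \<nu> * (c \<nu>)\<^sup>2 * ((norm a * Kb) ^ 3 * c \<nu> / 6 + (norm a * Kb) ^ 4 * (c \<nu>)\<^sup>2 / 8)" for \<nu>
      using centered_bounded_sum.charfun_approx[OF sums[of \<nu>], of a] unfolding card_I X_def
      by (simp add: power_mult_distrib algebra_simps power2_eq_square power3_eq_cube power4_eq_xxxx)
    have "(\<lambda>\<nu>. N \<nu> * (c \<nu>)\<^sup>2 * ((norm a * Kb) ^ 3 * c \<nu> / 6 + (norm a * Kb) ^ 4 * (c \<nu>)\<^sup>2 / 8))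
       \<longlonglongrightarrow> (inverse nbar)\<^sup>2 * ((norm a * Kb) ^ 3 * 0 / 6 + (norm a * Kb) ^ 4 * 0\<^sup>2 / 8)"
      by (intro tendsto_intros Nc2_lim c_lim) auto
    then have "(\<lambda>\<nu>. N \<nu> * (c \<nu>)\<^sup>2 * ((norm a * Kb) ^ 3 * c \<nu> / 6 + (norm a * Kb) ^ 4 * (c \<nu>)\<^sup>2 / 8)) \<longlonglongrightarrow> 0"
      by simp
    then have "(\<lambda>\<nu>. ?E \<nu> - ?L \<nu>) \<longlonglongrightarrow> 0"
      by (rule Lim_null_comparison[rotated]) (intro always_eventually allI bnd)
    moreover have "?L \<longlonglongrightarrow> complex_of_real (exp (- (K * (a \<bullet> (S0 *v a))) / 2))"
      by (intro tendsto_intros \<kappa>_lim) auto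
    ultimately have "(\<lambda>\<nu>. (?E \<nu> - ?L \<nu>) + ?L \<nu>) \<longlonglongrightarrow> 0 + complex_of_real (exp (- (K * (a \<bullet> (S0 *v a))) / 2))"
      by (rule tendsto_add)
    then show ?thesis
      by simp
  qed

  have tight_X: "\<exists>R>0. \<forall>\<^sub>F \<nu> in sequentially. measure (Mv \<nu>) {\<omega> \<in> space (Mv \<nu>). R \<le> norm (X \<nu> \<omega>)} \<le> e"
    if e: "0 < e" for e
  proof -
    \<comment> \<open>Any positive number strictly above the limiting second moment would do;
      \<open>R\<close> is then chosen so that Chebyshev's bound is exactly \<open>e\<close>.\<close>
    define m where "m = \<bar>K * (\<Sum>r\<in>UNIV. S0 $ r $ r)\<bar> + 1"
    have m: "0 < m"
      by (simp add: m_def)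
    define R where "R = sqrt (m / e)"
    have R: "0 < R" "m / R\<^sup>2 = e"
      using m e by (auto simp: R_def)
    have "(\<lambda>\<nu>. (\<Sum>i\<in>I \<nu>. \<kappa> \<nu> i) * (\<Sum>r\<in>UNIV. S0 $ r $ r)) \<longlonglongrightarrow> K * (\<Sum>r\<in>UNIV. S0 $ r $ r)"
      by (intro tendsto_mult \<kappa>_lim tendsto_const)
    then have "\<forall>\<^sub>F \<nu> in sequentially. (\<Sum>i\<in>I \<nu>. \<kappa> \<nu> i) * (\<Sum>r\<in>UNIV. S0 $ r $ r) < m"
      by (rule order_tendstoD) (simp add: m_def)
    then have "\<forall>\<^sub>F \<nu> in sequentially. measure (Mv \<nu>) {\<omega> \<in> space (Mv \<nu>). R \<le> norm (X \<nu> \<omega>)} \<le> e"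
    proof eventually_elim
      case (elim \<nu>)
      interpret centered_bounded_sum "Mv \<nu>" "I \<nu>" "U \<nu>" "\<kappa> \<nu>" S0 "c \<nu> * Kb"
        by (rule sums)
      have "measure (Mv \<nu>) {\<omega> \<in> space (Mv \<nu>). R \<le> norm (X \<nu> \<omega>)}
          \<le> (\<Sum>i\<in>I \<nu>. \<kappa> \<nu> i) * (\<Sum>r\<in>UNIV. S0 $ r $ r) / R\<^sup>2"
        using Chebyshev_norm[OF integrable_norm2 R(1)] by (simp add: X_def second_moment_norm)
      also have "\<dots> \<le> m / R\<^sup>2"
        using elim R(1) by (intro divide_right_mono) auto
      finally show ?case
        by (simp add: R)
    qed
    with R show ?thesis
      by blast
  qed

  have X_eq: "X \<nu> \<omega> = sqrt (N \<nu>) *\<^sub>R (phat \<nu> \<omega> - p0)" if "D \<nu> \<noteq> 0" for \<nu> \<omega>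
  proof -
    have "X \<nu> \<omega> = c \<nu> *\<^sub>R ((\<Sum>g<G. \<Sum>l<Nc \<nu> g. Y \<nu> g l \<omega>) - (\<Sum>g<G. \<Sum>l<Nc \<nu> g. real (n g) *\<^sub>R p0))"
      unfolding X_def U_def sum_I sum_subtractf[symmetric] scaleR_sum_right
      by (intro sum.cong) auto
    also have "(\<Sum>g<G. \<Sum>l<Nc \<nu> g. real (n g) *\<^sub>R p0) = D \<nu> *\<^sub>R p0"
      by (simp add: D_def scaleR_sum_left mult.commute sum_constant_scaleR del: sum_constant)
    also have "(\<Sum>g<G. \<Sum>l<Nc \<nu> g. Y \<nu> g l \<omega>) = D \<nu> *\<^sub>R phat \<nu> \<omega>"
      unfolding phat_def D_def[symmetric] using that by simp
    finally show ?thesis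
      using that by (simp add: c_def flip: scaleR_diff_right)
  qed
  have phat_sum: "(\<Sum>r\<in>UNIV. phat \<nu> \<omega> $ r) = 1" if "D \<nu> \<noteq> 0" "\<omega> \<in> space (Mv \<nu>)" for \<nu> \<omega>
  proof -
    have "(\<Sum>r\<in>UNIV. (\<Sum>g<G. \<Sum>l<Nc \<nu> g. Y \<nu> g l \<omega>) $ r) = (\<Sum>g<G. \<Sum>l<Nc \<nu> g. \<Sum>r\<in>UNIV. Y \<nu> g l \<omega> $ r)"
      by (simp add: sum.swap[of _ _ "UNIV :: 'm set"])
    also have "\<dots> = D \<nu>"
      using Y_values that(2) by (simp add: D_def mult.commute)
    finally show ?thesis
      unfolding phat_def D_def[symmetric] using that(1) by (simp flip: sum_divide_distrib)
  qed

  \<comment> \<open>Division by zero gives 0, so eventual positivity of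
    \<open>N \<nu> / D \<nu>\<close> excludes \<open>D \<nu> = 0\<close>.\<close>
  have D_pos: "\<forall>\<^sub>F \<nu> in sequentially. D \<nu> \<noteq> 0"
    using order_tendstoD(1)[OF ND_lim, of 0] nbar_pos by (auto elim: eventually_mono)
  have approx: "\<forall>\<^sub>F \<nu> in sequentially. \<forall>\<omega>\<in>space (Mv \<nu>). norm (X \<nu> \<omega>) < R \<longrightarrow>
      norm (V \<nu> \<omega> - residual_map W S0 (X \<nu> \<omega>)) \<le> \<eta>" if R: "0 < R" and \<eta>: "0 < \<eta>" for R \<eta>
  proof -
    \<comment> \<open>A relative error of \<open>\<eta> / R\<close> becomes an absolute error of at
      most \<open>\<eta>\<close> after rescaling, on the event that \<open>X\<close> is below
      \<open>R\<close>.\<close>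
    have "0 < \<eta> / R"
      using R \<eta> by simp
    then obtain \<delta> where \<delta>: "0 < \<delta>"
      "\<And>p \<theta>. \<lbrakk>(\<Sum>r\<in>UNIV. p $ r) = 1; norm (p - p0) < \<delta>;
         \<And>\<theta>'. d_phi \<phi> p (loglin_p W \<theta>) \<le> d_phi \<phi> p (loglin_p W \<theta>')\<rbrakk>
        \<Longrightarrow> norm (p - loglin_p W \<theta> - residual_map W S0 (p - p0)) \<le> \<eta> / R * norm (p - p0)"
      using minimum_phi_expansion[OF W_one_indep phi_adm, of "\<eta> / R" \<theta>0] unfolding S0_def p0_def by metis
    \<comment> \<open>On that event the deviation of \<open>phat\<close> is below
      \<open>R / sqrt (N \<nu>)\<close>, which is eventually less than
      \<open>\<delta>\<close>.\<close>
    have "\<forall>\<^sub>F \<nu> in sequentially. R / \<delta> < sqrt (N \<nu>)"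
      using sqrtN_lim by (simp add: filterlim_at_top_dense)
    with D_pos show ?thesis
    proof eventually_elim
      case (elim \<nu>)
      have "0 < R / \<delta>"
        using R \<delta>(1) by simp
      then have sq: "0 < sqrt (N \<nu>)"
        using elim(2) by (rule less_trans)
      have sq\<delta>: "R < sqrt (N \<nu>) * \<delta>"
        using elim(2) \<delta>(1) by (simp add: pos_divide_less_eq)
      show ?case
      proof (intro ballI impI)
        fix \<omega> assume \<omega>: "\<omega> \<in> space (Mv \<nu>)" and "norm (X \<nu> \<omega>) < R"
        then have nX: "sqrt (N \<nu>) * norm (phat \<nu> \<omega> - p0) < R"
          using sq by (simp add: X_eq[OF elim(1)])
        then have "sqrt (N \<nu>) * norm (phat \<nu> \<omega> - p0) < sqrt (N \<nu>) * \<delta>"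
          using sq\<delta> by linarith
        then have near: "norm (phat \<nu> \<omega> - p0) < \<delta>"
          using sq by simp
        have "V \<nu> \<omega> - residual_map W S0 (X \<nu> \<omega>) =
            sqrt (N \<nu>) *\<^sub>R (phat \<nu> \<omega> - loglin_p W (thetahat \<nu> \<omega>) - residual_map W S0 (phat \<nu> \<omega> - p0))"
          unfolding V_def X_eq[OF elim(1)] linear_cmul[OF linear_residual_map]
          by (simp add: scaleR_diff_right)
        then have "norm (V \<nu> \<omega> - residual_map W S0 (X \<nu> \<omega>)) =
            sqrt (N \<nu>) * norm (phat \<nu> \<omega> - loglin_p W (thetahat \<nu> \<omega>) - residual_map W S0 (phat \<nu> \<omega> - p0))"
          using sq by simp
        also have "\<dots> \<le> sqrt (N \<nu>) * (\<eta> / R * norm (phat \<nu> \<omega> - p0))"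
          using sq thetahat_min \<omega> phat_sum[OF elim(1) \<omega>] near
          by (intro mult_left_mono \<delta>(2)) auto
        also have "\<dots> = \<eta> / R * (sqrt (N \<nu>) * norm (phat \<nu> \<omega> - p0))"
          by simp
        also have "\<dots> \<le> \<eta> / R * R"
          using nX R \<eta> by (intro mult_left_mono) auto
        finally show "norm (V \<nu> \<omega> - residual_map W S0 (X \<nu> \<omega>)) \<le> \<eta>"
          using R by simp
      qed
    qed
  qed

  have X_meas: "X \<nu> \<in> borel_measurable (Mv \<nu>)" for \<nu>
    unfolding X_def by (intro borel_measurable_sum centered_bounded_sum.U_measurable[OF sums])
  have V_meas: "V \<nu> \<in> borel_measurable (Mv \<nu>)" for \<nu>
  proof -
    have "(\<lambda>\<omega>. \<Sum>g<G. \<Sum>l<Nc \<nu> g. Y \<nu> g l \<omega>) \<in> borel_measurable (Mv \<nu>)"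
      using Y_meas by (intro borel_measurable_sum) auto
    moreover have "(\<lambda>\<omega>. loglin_p W (thetahat \<nu> \<omega>)) \<in> borel_measurable (Mv \<nu>)"
      using thetahat_meas
      by (intro measurable_compose[of "thetahat \<nu>" _ borel "loglin_p W"]
          borel_measurable_continuous_onI continuous_on_loglin_p) auto
    ultimately show ?thesis
      unfolding V_def phat_def by (intro borel_measurable_scaleR borel_measurable_diff borel_measurable_const)
  qed

  let ?C = "S0 - S0 ** W ** matrix_inv (transpose W ** S0 ** W) ** transpose W ** S0"
  let ?adj = "adjoint (residual_map W S0)"
  have quad: "?adj t \<bullet> (S0 *v ?adj t) = t \<bullet> (?C *v t)" for t
    unfolding S0_def
    by (intro residual_quadratic_form Fisher_information_invertible W_one_indep inner_Sigma_mat_commute)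
  obtain \<mu> :: "(real^'m) measure" where \<mu>: "prob_space \<mu>" "sets \<mu> = sets borel"
    "\<And>t. (\<integral>x. cis (t \<bullet> x) \<partial>\<mu>) = complex_of_real (exp (- (K * (?adj t \<bullet> (S0 *v ?adj t))) / 2))"
  proof -
    \<comment> \<open>The limiting covariance is \<open>K\<close> times \<open>S0\<close> sandwiched
      between the residual map and its adjoint, so \<open>f\<close> applies the factor of
      \<open>S0\<close> after the adjoint; \<open>K_nonneg\<close> justifies
      \<open>sqrt K\<close>.\<close>
    define f where "f t = sqrt K *\<^sub>R Sigma_root p0 (?adj t)" for t
    have "linear f"
      unfolding f_def
      by (intro linear_compose_scale_right linear_compose[OF adjoint_linear[OF linear_residual_map] linear_Sigma_root, unfolded o_def])
    moreover have "(norm (f t))\<^sup>2 = K * (?adj t \<bullet> (S0 *v ?adj t))" for t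
      using K_nonneg p0(1) loglin_p_sum[of W \<theta>0]
      by (simp add: f_def power_mult_distrib S0 norm_Sigma_root less_imp_le p0_def[symmetric])
    ultimately show thesis
      using gaussian_measure_exists[of f] that by auto
  qed
  have "is_centered_mvn (K *\<^sub>R ?C) \<mu>"
    unfolding is_centered_mvn_def using \<mu> by (simp add: quad scaleR_matrix_vector_assoc[symmetric])
  moreover have "conv_in_law (\<lambda>\<nu>. distr (Mv \<nu>) borel (V \<nu>)) \<mu>"
    by (rule conv_in_law_approx_linear[OF _ X_meas V_meas linear_residual_map char_X tight_X approx \<mu>])
      (use prob in auto)
  ultimately show ?thesis
    unfolding K_def V_def N_def by blast
qed

end
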